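(* The list nerve construction $\mathcal{P}\mapsto N^l(\mathcal{P})$ extends to a fully faithful functor $N^l:\mathsf{Op}\to\mathsf{sList}$ from the category of operads to the category of simplicial lists.
   Context: **Lists.** For a set $X$, $\mathcal{L}X=\coprod_{n\ge 0}X^n$ is the set of finite sequences in $X$. A listing from $A$ to $X$ is a function $u:A\to\mathcal{L}X$; listings compose by concatenation: if $u(a)=(x_1,\dots,x_k)$ then $(vu)(a)=v(x_1)*\dots*v(x_k)$. $\mathsf{List}$ is the category of sets and listings; a function is viewed as a listing all of whose values have length $1$. A simplicial list is a functor $X:\Delta^{op}\to\mathsf{List}$; $\mathsf{sList}$ is the category of simplicial lists with morphisms the natural transformations all of whose components are functions. **Operads.** "Operad" means coloured non-symmetric operad in sets (nullary operations allowed); $\mathsf{Op}$ is the category of operads and structure-preserving maps. **Leveled trees.** $\Delta_+$ is the category of finite (possibly empty) totally ordered sets and order-preserving maps, objects up to unique isomorphism. An $n$-simplex $\alpha$ of its nerve $N(\Delta_+)$ is a chain $A_0\xrightarrow{\alpha_1}A_1\to\dots\xrightarrow{\alpha_n}A_n$, with composites $\alpha_{i,j}:A_i\to A_j$. It is rooted if $A_n$ has exactly one element. For $a\in A_n$, $\alpha_a$ is the rooted simplex obtained by restricting the chain to the preimages of $\{a\}$. $T_\alpha$ is the free operad with colours $\coprod_{i=0}^nA_i$ and generating operations $p_i^{(a)}:\alpha_i^{-1}(a)\to a$ for $1\le i\le n$, $a\in A_i$. For $i\le j$ and $a\in A_j$, $p_{i,j}^{(a)}:\alpha_{i,j}^{-1}(a)\to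 a$ is the evident composite of generators ($p_{i,i}^{(a)}=1_a$). For $\theta:[k]\to[n]$, $\lambda_\theta:T_{\theta^*\alpha}\to T_\alpha$ sends a colour $b$ in level $i$ of $\theta^*\alpha$ to $b\in A_{\theta(i)}$ and $p_i^{(b)}$ to $p_{\theta(i-1),\theta(i)}^{(b)}$. **List nerve.** $N^l(\mathcal{P})_n=\coprod_{\alpha\in N(\Delta_+)_n\text{ rooted}}\mathsf{Op}(T_\alpha,\mathcal{P})$. For $\theta:[k]\to[n]$ and $x:T_\alpha\to\mathcal{P}$, $\theta^*x$ is the list $((\theta,a)^*x)_{a\in A_{\theta(k)}}$, where $(\theta,a)^*x$ is the composite $T_{(\theta^*\alpha)_a}\subseteq T_{\theta^*\alpha}\xrightarrow{\lambda_\theta}T_\alpha\xrightarrow{x}\mathcal{P}$. A morphism of operads acts by post-composition. *)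

theory Defs
  imports "HOL-Library.FuncSet"
begin

section \<open>Categories, functors, natural transformations\<close>

text \<open>
  Hom-sets of different pairs of objects need not be disjoint, so composition receives the objects:
  \<open>Comp C a b c g f\<close> is \<open>g\<close> after \<open>f\<close> for \<open>f : a \<rightarrow> b\<close> and \<open>g : b \<rightarrow> c\<close>.
  Values of operations outside their intended domain are unconstrained; maps that are elements of
  hom-sets are made extensional, so that equality of morphisms is equality in HOL.
\<close>

record ('a, 'm) category =
  Obj :: "'a set"
  Hom :: "'a \<Rightarrow> 'a \<Rightarrow> 'm set"
  Id :: "'a \<Rightarrow> 'm"
  Comp :: "'a \<Rightarrow> 'a \<Rightarrow> 'a \<Rightarrow> 'm \<Rightarrow> 'm \<Rightarrow> 'm"

locale category =
  fixes C :: "('a, 'm) category"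
  assumes Id_in_Hom: "a \<in> Obj C \<Longrightarrow> Id C a \<in> Hom C a a"
    and Comp_in_Hom: "\<lbrakk>a \<in> Obj C; b \<in> Obj C; c \<in> Obj C; f \<in> Hom C a b; g \<in> Hom C b c\<rbrakk>
      \<Longrightarrow> Comp C a b c g f \<in> Hom C a c"
    and Comp_Id_left: "\<lbrakk>a \<in> Obj C; b \<in> Obj C; f \<in> Hom C a b\<rbrakk> \<Longrightarrow> Comp C a b b (Id C b) f = f"
    and Comp_Id_right: "\<lbrakk>a \<in> Obj C; b \<in> Obj C; f \<in> Hom C a b\<rbrakk> \<Longrightarrow> Comp C a a b f (Id C a) = f"
    and Comp_assoc: "\<lbrakk>a \<in> Obj C; b \<in> Obj C; c \<in> Obj C; d \<in> Obj C;
        f \<in> Hom C a b; g \<in> Hom C b c; h \<in> Hom C c d\<rbrakk>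
      \<Longrightarrow> Comp C a b d (Comp C b c d h g) f = Comp C a c d h (Comp C a b c g f)"

definition opposite :: "('a, 'm) category \<Rightarrow> ('a, 'm) category" where
  "opposite C = \<lparr>Obj = Obj C, Hom = (\<lambda>a b. Hom C b a), Id = Id C,
     Comp = (\<lambda>a b c g f. Comp C c b a f g)\<rparr>"

record ('a, 'm, 'b, 'n) functor_data =
  F_ob :: "'a \<Rightarrow> 'b"
  F_ar :: "'a \<Rightarrow> 'a \<Rightarrow> 'm \<Rightarrow> 'n"

locale cat_functor = dom: category C + cod: category D
  for C :: "('a, 'm) category" and D :: "('b, 'n) category" +
  fixes F :: "('a, 'm, 'b, 'n) functor_data"
  assumes F_ob_in: "a \<in> Obj C \<Longrightarrow> F_ob F a \<in> Obj D"
    and F_ar_in: "\<lbrakk>a \<in> Obj C; b \<in> Obj C; f \<in> Hom C a b\<rbrakk>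
      \<Longrightarrow> F_ar F a b f \<in> Hom D (F_ob F a) (F_ob F b)"
    and F_Id: "a \<in> Obj C \<Longrightarrow> F_ar F a a (Id C a) = Id D (F_ob F a)"
    and F_Comp: "\<lbrakk>a \<in> Obj C; b \<in> Obj C; c \<in> Obj C; f \<in> Hom C a b; g \<in> Hom C b c\<rbrakk>
      \<Longrightarrow> F_ar F a c (Comp C a b c g f)
        = Comp D (F_ob F a) (F_ob F b) (F_ob F c) (F_ar F b c g) (F_ar F a b f)"

locale fully_faithful_functor = cat_functor C D F
  for C :: "('a, 'm) category" and D :: "('b, 'n) category"
    and F :: "('a, 'm, 'b, 'n) functor_data" +
  assumes bij_on_Hom: "\<lbrakk>a \<in> Obj C; b \<in> Obj C\<rbrakk>
      \<Longrightarrow> bij_betw (F_ar F a b) (Hom C a b) (Hom D (F_ob F a) (F_ob F b))"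

definition nat_transfs :: "('a, 'm) category \<Rightarrow> ('b, 'n) category \<Rightarrow> ('a, 'm, 'b, 'n) functor_data
    \<Rightarrow> ('a, 'm, 'b, 'n) functor_data \<Rightarrow> ('a \<Rightarrow> 'n) set" where
  "nat_transfs C D F G =
    {\<eta> \<in> (\<Pi>\<^sub>E a\<in>Obj C. Hom D (F_ob F a) (F_ob G a)).
      \<forall>a\<in>Obj C. \<forall>b\<in>Obj C. \<forall>f\<in>Hom C a b.
        Comp D (F_ob F a) (F_ob F b) (F_ob G b) (\<eta> b) (F_ar F a b f)
        = Comp D (F_ob F a) (F_ob G a) (F_ob G b) (F_ar G a b f) (\<eta> a)}"


section \<open>Simplicial lists\<close>

definition order_maps :: "nat set \<Rightarrow> nat set \<Rightarrow> (nat \<Rightarrow> nat) set" where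
  "order_maps A B = {f \<in> A \<rightarrow>\<^sub>E B. mono_on A f}"

text \<open>The object \<open>n\<close> of the simplex category stands for \<open>{0, \<dots>, n}\<close>.\<close>

definition simplex_cat :: "(nat, nat \<Rightarrow> nat) category" where
  "simplex_cat = \<lparr>Obj = UNIV, Hom = (\<lambda>k n. order_maps {..k} {..n}),
     Id = (\<lambda>n. \<lambda>i\<in>{..n}. i), Comp = (\<lambda>k m n g f. compose {..k} g f)\<rparr>"

definition List_cat :: "('x set, 'x \<Rightarrow> 'x list) category" where
  "List_cat = \<lparr>Obj = UNIV, Hom = (\<lambda>A X. A \<rightarrow>\<^sub>E lists X), Id = (\<lambda>A. \<lambda>a\<in>A. [a]),
     Comp = (\<lambda>A B C v u. \<lambda>a\<in>A. concat (map v (u a)))\<rparr>"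

text \<open>
  For \<open>\<theta> : [k] \<rightarrow> [n]\<close> and a simplicial list \<open>X\<close>, the listing
  \<open>\<theta>\<^sup>*\<close> from \<open>X\<^sub>n\<close> to \<open>X\<^sub>k\<close> is \<open>F_ar X n k \<theta>\<close>.
\<close>

type_synonym 'x slist = "(nat, nat \<Rightarrow> nat, 'x set, 'x \<Rightarrow> 'x list) functor_data"

definition slist_hom :: "'x slist \<Rightarrow> 'x slist \<Rightarrow> (nat \<Rightarrow> 'x \<Rightarrow> 'x list) set" where
  "slist_hom X Y = {\<eta> \<in> nat_transfs (opposite simplex_cat) List_cat X Y.
     \<forall>n. \<forall>x\<in>F_ob X n. length (\<eta> n x) = 1}"

definition sList_cat :: "('x slist, nat \<Rightarrow> 'x \<Rightarrow> 'x list) category" where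
  "sList_cat = \<lparr>Obj = {X. cat_functor (opposite simplex_cat) List_cat X}, Hom = slist_hom,
     Id = (\<lambda>X n. Id List_cat (F_ob X n)),
     Comp = (\<lambda>X Y Z \<tau> \<sigma> n. Comp List_cat (F_ob X n) (F_ob Y n) (F_ob Z n) (\<tau> n) (\<sigma> n))\<rparr>"


section \<open>Coloured non-symmetric operads\<close>

record ('c, 'o) operad =
  colours :: "'c set"
  operations :: "'o set"
  inputs :: "'o \<Rightarrow> 'c list"
  target :: "'o \<Rightarrow> 'c"
  op_unit :: "'c \<Rightarrow> 'o"
  op_comp :: "'o \<Rightarrow> 'o list \<Rightarrow> 'o"

definition composable :: "('c, 'o) operad \<Rightarrow> 'o \<Rightarrow> 'o list \<Rightarrow> bool" where
  "composable P p qs \<longleftrightarrow>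
     p \<in> operations P \<and> set qs \<subseteq> operations P \<and> map (target P) qs = inputs P p"

locale operad =
  fixes P :: "('c, 'o) operad"
  assumes inputs_in: "p \<in> operations P \<Longrightarrow> set (inputs P p) \<subseteq> colours P"
    and target_in: "p \<in> operations P \<Longrightarrow> target P p \<in> colours P"
    and unit_in: "c \<in> colours P \<Longrightarrow> op_unit P c \<in> operations P"
    and inputs_unit: "c \<in> colours P \<Longrightarrow> inputs P (op_unit P c) = [c]"
    and target_unit: "c \<in> colours P \<Longrightarrow> target P (op_unit P c) = c"
    and comp_in: "composable P p qs \<Longrightarrow> op_comp P p qs \<in> operations P"
    and inputs_comp: "composable P p qs \<Longrightarrow> inputs P (op_comp P p qs) = concat (map (inputs P) qs)"
    and target_comp: "composable P p qs \<Longrightarrow> target P (op_comp P p qs) = target P p"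
    and comp_unit_left: "p \<in> operations P \<Longrightarrow> op_comp P (op_unit P (target P p)) [p] = p"
    and comp_unit_right: "p \<in> operations P \<Longrightarrow> op_comp P p (map (op_unit P) (inputs P p)) = p"
    and comp_assoc: "\<lbrakk>composable P p qs; list_all2 (composable P) qs rss\<rbrakk>
      \<Longrightarrow> op_comp P (op_comp P p qs) (concat rss) = op_comp P p (map2 (op_comp P) qs rss)"

text \<open>A map of operads is a pair consisting of its actions on colours and on operations.\<close>

definition op_hom :: "('c, 'o) operad \<Rightarrow> ('d, 'p) operad \<Rightarrow> (('c \<Rightarrow> 'd) \<times> ('o \<Rightarrow> 'p)) set" where
  "op_hom P Q = {(f, g). f \<in> colours P \<rightarrow>\<^sub>E colours Q \<and> g \<in> operations P \<rightarrow>\<^sub>E operations Q \<and>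
     (\<forall>p\<in>operations P. inputs Q (g p) = map f (inputs P p) \<and> target Q (g p) = f (target P p)) \<and>
     (\<forall>c\<in>colours P. g (op_unit P c) = op_unit Q (f c)) \<and>
     (\<forall>p qs. composable P p qs \<longrightarrow> g (op_comp P p qs) = op_comp Q (g p) (map g qs))}"

definition op_hom_id :: "('c, 'o) operad \<Rightarrow> ('c \<Rightarrow> 'c) \<times> ('o \<Rightarrow> 'o)" where
  "op_hom_id P = (\<lambda>c\<in>colours P. c, \<lambda>p\<in>operations P. p)"

definition op_hom_comp :: "('c, 'o) operad \<Rightarrow> ('d \<Rightarrow> 'e) \<times> ('p \<Rightarrow> 'q) \<Rightarrow> ('c \<Rightarrow> 'd) \<times> ('o \<Rightarrow> 'p)
    \<Rightarrow> ('c \<Rightarrow> 'e) \<times> ('o \<Rightarrow> 'q)" where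
  "op_hom_comp P g f = (compose (colours P) (fst g) (fst f), compose (operations P) (snd g) (snd f))"

definition Op_cat :: "(('c, 'o) operad, ('c \<Rightarrow> 'c) \<times> ('o \<Rightarrow> 'o)) category" where
  "Op_cat = \<lparr>Obj = {P. operad P}, Hom = op_hom, Id = op_hom_id,
     Comp = (\<lambda>P Q R g f. op_hom_comp P g f)\<rparr>"


section \<open>Free operads\<close>

text \<open>
  Operations of the free operad are planar trees with vertices labelled by generators and leaves
  labelled by colours; a single leaf is a unit, and composition grafts trees onto the leaves.
\<close>

datatype ('c, 'g) op_tree = Leaf 'c | Node 'g "('c, 'g) op_tree list"

primrec leaves :: "('c, 'g) op_tree \<Rightarrow> 'c list" where
  "leaves (Leaf c) = [c]"
| "leaves (Node g ts) = concat (map leaves ts)"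

primrec root :: "('g \<Rightarrow> 'c) \<Rightarrow> ('c, 'g) op_tree \<Rightarrow> 'c" where
  "root tgt (Leaf c) = c"
| "root tgt (Node g ts) = tgt g"

inductive_set wf_trees :: "'c set \<Rightarrow> 'g set \<Rightarrow> ('g \<Rightarrow> 'c list) \<Rightarrow> ('g \<Rightarrow> 'c) \<Rightarrow> ('c, 'g) op_tree set"
  for C :: "'c set" and G :: "'g set" and src :: "'g \<Rightarrow> 'c list" and tgt :: "'g \<Rightarrow> 'c" where
  Leaf: "c \<in> C \<Longrightarrow> Leaf c \<in> wf_trees C G src tgt"
| Node: "\<lbrakk>g \<in> G; \<forall>t\<in>set ts. t \<in> wf_trees C G src tgt; map (root tgt) ts = src g\<rbrakk>
    \<Longrightarrow> Node g ts \<in> wf_trees C G src tgt"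

primrec chop :: "nat list \<Rightarrow> 'a list \<Rightarrow> 'a list list" where
  "chop [] xs = []"
| "chop (n # ns) xs = take n xs # chop ns (drop n xs)"

primrec graft :: "('c, 'g) op_tree \<Rightarrow> ('c, 'g) op_tree list \<Rightarrow> ('c, 'g) op_tree" where
  "graft (Leaf c) = (\<lambda>us. hd us)"
| "graft (Node g ts) = (\<lambda>us. Node g
     (map2 (\<lambda>h vs. h vs) (map graft ts) (chop (map (\<lambda>t. length (leaves t)) ts) us)))"

definition free_operad :: "'c set \<Rightarrow> 'g set \<Rightarrow> ('g \<Rightarrow> 'c list) \<Rightarrow> ('g \<Rightarrow> 'c)
    \<Rightarrow> ('c, ('c, 'g) op_tree) operad" where
  "free_operad C G src tgt = \<lparr>colours = C, operations = wf_trees C G src tgt, inputs = leaves,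
     target = root tgt, op_unit = Leaf, op_comp = graft\<rparr>"

primrec eval_tree :: "('d, 'p) operad \<Rightarrow> ('c \<Rightarrow> 'd) \<Rightarrow> ('g \<Rightarrow> 'p) \<Rightarrow> ('c, 'g) op_tree \<Rightarrow> 'p" where
  "eval_tree Q f h (Leaf c) = op_unit Q (f c)"
| "eval_tree Q f h (Node g ts) = op_comp Q (h g) (map (eval_tree Q f h) ts)"

text \<open>
  The operad map from a free operad \<open>F\<close> to \<open>Q\<close> given by \<open>f\<close> on colours
  and by \<open>h\<close> on generators.
\<close>

definition induced_hom :: "('c, ('c, 'g) op_tree) operad \<Rightarrow> ('d, 'p) operad \<Rightarrow> ('c \<Rightarrow> 'd)
    \<Rightarrow> ('g \<Rightarrow> 'p) \<Rightarrow> ('c \<Rightarrow> 'd) \<times> (('c, 'g) op_tree \<Rightarrow> 'p)" where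
  "induced_hom F Q f h = (restrict f (colours F), restrict (eval_tree Q f h) (operations F))"


section \<open>Leveled trees\<close>

text \<open>
  We use the skeleton of the category of finite ordinals in which the ordinal of size \<open>m\<close> is
  \<open>{..<m}\<close>. A chain of length \<open>n\<close> has the ordinals \<open>{..<level \<alpha> i}\<close> for
  \<open>i \<le> n\<close>, and \<open>step \<alpha> i\<close> is the map from level \<open>i - 1\<close> to level \<open>i\<close>.
\<close>

record chain =
  len :: nat
  level :: "nat \<Rightarrow> nat"
  step :: "nat \<Rightarrow> nat \<Rightarrow> nat"

definition chains :: "nat \<Rightarrow> chain set" where
  "chains n = {\<alpha>. len \<alpha> = n \<and> level \<alpha> \<in> extensional {..n} \<and>
     step \<alpha> \<in> (\<Pi>\<^sub>E i\<in>{1..n}. order_maps {..<level \<alpha> (i - 1)} {..<level \<alpha> i})}"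

definition rooted :: "chain \<Rightarrow> bool" where
  "rooted \<alpha> \<longleftrightarrow> level \<alpha> (len \<alpha>) = 1"

text \<open>The composite from level \<open>i\<close> to level \<open>j\<close>, for \<open>i \<le> j\<close>.\<close>

definition link :: "chain \<Rightarrow> nat \<Rightarrow> nat \<Rightarrow> nat \<Rightarrow> nat" where
  "link \<alpha> i j b = fold (step \<alpha>) [Suc i..<Suc j] b"

text \<open>The preimage of \<open>a\<close> in level \<open>i\<close>, listed in increasing order.\<close>

definition fibre :: "chain \<Rightarrow> nat \<Rightarrow> nat \<Rightarrow> nat \<Rightarrow> nat list" where
  "fibre \<alpha> i j a = filter (\<lambda>b. link \<alpha> i j b = a) [0..<level \<alpha> i]"

definition pullback :: "nat \<Rightarrow> (nat \<Rightarrow> nat) \<Rightarrow> chain \<Rightarrow> chain" where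
  "pullback k \<theta> \<alpha> = \<lparr>len = k, level = (\<lambda>i\<in>{..k}. level \<alpha> (\<theta> i)),
     step = (\<lambda>i\<in>{1..k}. \<lambda>b\<in>{..<level \<alpha> (\<theta> (i - 1))}. link \<alpha> (\<theta> (i - 1)) (\<theta> i) b)\<rparr>"

text \<open>
  The restriction \<open>\<alpha>\<^sub>a\<close>: its level \<open>i\<close> is the fibre over \<open>a\<close>,
  replaced by the isomorphic ordinal of the skeleton via \<open>b \<mapsto> fibre \<alpha> i (len \<alpha>) a ! b\<close>.
\<close>

definition branch :: "chain \<Rightarrow> nat \<Rightarrow> chain" where
  "branch \<alpha> a =
    (let \<phi> = (\<lambda>i. fibre \<alpha> i (len \<alpha>) a) in
     \<lparr>len = len \<alpha>, level = (\<lambda>i\<in>{..len \<alpha>}. length (\<phi> i)),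
      step = (\<lambda>i\<in>{1..len \<alpha>}. \<lambda>b\<in>{..<length (\<phi> (i - 1))}.
        inv_into {..<length (\<phi> i)} ((!) (\<phi> i)) (step \<alpha> i (\<phi> (i - 1) ! b)))\<rparr>)"

text \<open>
  In \<open>T\<^sub>\<alpha>\<close> the pair \<open>(i, a)\<close> is the colour \<open>a\<close> of level \<open>i\<close>; for
  \<open>i \<ge> 1\<close> it also labels the generator with that output.
\<close>

type_synonym lev_tree = "(nat \<times> nat, nat \<times> nat) op_tree"

definition tree_operad :: "chain \<Rightarrow> (nat \<times> nat, lev_tree) operad" where
  "tree_operad \<alpha> = free_operad
     {(i, a). i \<le> len \<alpha> \<and> a < level \<alpha> i}
     {(i, a). 1 \<le> i \<and> i \<le> len \<alpha> \<and> a < level \<alpha> i}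
     (\<lambda>(i, a). map (Pair (i - 1)) (fibre \<alpha> (i - 1) i a))
     (\<lambda>(i, a). (i, a))"

definition gen :: "chain \<Rightarrow> nat \<Rightarrow> nat \<Rightarrow> lev_tree" where
  "gen \<alpha> i a = Node (i, a) (map (\<lambda>b. Leaf (i - 1, b)) (fibre \<alpha> (i - 1) i a))"

text \<open>The composite \<open>p\<^sub>i\<^sub>,\<^sub>j\<close> with output \<open>(j, a)\<close>, for \<open>i \<le> j\<close>.\<close>

primrec gen_comp :: "chain \<Rightarrow> nat \<Rightarrow> nat \<Rightarrow> nat \<Rightarrow> lev_tree" where
  "gen_comp \<alpha> i 0 a = op_unit (tree_operad \<alpha>) (0, a)"
| "gen_comp \<alpha> i (Suc j) a =
    (if i = Suc j then op_unit (tree_operad \<alpha>) (Suc j, a)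
     else op_comp (tree_operad \<alpha>) (gen \<alpha> (Suc j) a) (map (gen_comp \<alpha> i j) (fibre \<alpha> j (Suc j) a)))"

definition tree_pull :: "nat \<Rightarrow> (nat \<Rightarrow> nat) \<Rightarrow> chain
    \<Rightarrow> (nat \<times> nat \<Rightarrow> nat \<times> nat) \<times> (lev_tree \<Rightarrow> lev_tree)" where
  "tree_pull k \<theta> \<alpha> = induced_hom (tree_operad (pullback k \<theta> \<alpha>)) (tree_operad \<alpha>)
     (\<lambda>(i, b). (\<theta> i, b)) (\<lambda>(i, b). gen_comp \<alpha> (\<theta> (i - 1)) (\<theta> i) b)"

text \<open>The inclusion of the operad of \<open>\<alpha>\<^sub>a\<close> into that of \<open>\<alpha>\<close>.\<close>

definition tree_incl :: "chain \<Rightarrow> nat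
    \<Rightarrow> (nat \<times> nat \<Rightarrow> nat \<times> nat) \<times> (lev_tree \<Rightarrow> lev_tree)" where
  "tree_incl \<alpha> a = induced_hom (tree_operad (branch \<alpha> a)) (tree_operad \<alpha>)
     (\<lambda>(i, b). (i, fibre \<alpha> i (len \<alpha>) a ! b)) (\<lambda>(i, b). gen \<alpha> i (fibre \<alpha> i (len \<alpha>) a ! b))"


section \<open>The list nerve\<close>

type_synonym ('c, 'o) nerve_simplex = "chain \<times> ((nat \<times> nat \<Rightarrow> 'c) \<times> (lev_tree \<Rightarrow> 'o))"

definition nerve_simplices :: "('c, 'o) operad \<Rightarrow> nat \<Rightarrow> ('c, 'o) nerve_simplex set" where
  "nerve_simplices P n = (SIGMA \<alpha>:{\<alpha> \<in> chains n. rooted \<alpha>}. op_hom (tree_operad \<alpha>) P)"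

definition nerve_face :: "nat \<Rightarrow> (nat \<Rightarrow> nat) \<Rightarrow> nat \<Rightarrow> ('c, 'o) nerve_simplex
    \<Rightarrow> ('c, 'o) nerve_simplex" where
  "nerve_face k \<theta> a = (\<lambda>(\<alpha>, x).
     let \<beta> = pullback k \<theta> \<alpha>; T = tree_operad (branch \<beta> a)
     in (branch \<beta> a, op_hom_comp T x (op_hom_comp T (tree_pull k \<theta> \<alpha>) (tree_incl \<beta> a))))"

definition list_nerve_ob :: "('c, 'o) operad \<Rightarrow> ('c, 'o) nerve_simplex slist" where
  "list_nerve_ob P = \<lparr>F_ob = nerve_simplices P,
     F_ar = (\<lambda>n k \<theta>. \<lambda>(\<alpha>, x)\<in>nerve_simplices P n.
       map (\<lambda>a. nerve_face k \<theta> a (\<alpha>, x)) [0..<level \<alpha> (\<theta> k)])\<rparr>"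

definition list_nerve_ar :: "('c, 'o) operad \<Rightarrow> ('c, 'o) operad \<Rightarrow> ('c \<Rightarrow> 'c) \<times> ('o \<Rightarrow> 'o)
    \<Rightarrow> nat \<Rightarrow> ('c, 'o) nerve_simplex \<Rightarrow> ('c, 'o) nerve_simplex list" where
  "list_nerve_ar P Q f n =
     (\<lambda>(\<alpha>, x)\<in>nerve_simplices P n. [(\<alpha>, op_hom_comp (tree_operad \<alpha>) f x)])"

definition list_nerve :: "(('c, 'o) operad, ('c \<Rightarrow> 'c) \<times> ('o \<Rightarrow> 'o), ('c, 'o) nerve_simplex slist,
    nat \<Rightarrow> ('c, 'o) nerve_simplex \<Rightarrow> ('c, 'o) nerve_simplex list) functor_data" where
  "list_nerve = \<lparr>F_ob = list_nerve_ob, F_ar = list_nerve_ar\<rparr>"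

end

theory Submission
  imports Defs
begin

text \<open>
  A simplex \<open>x : T\<^sub>\<alpha> \<rightarrow> P\<close> is determined by its shape \<open>\<alpha>\<close>, the colours \<open>x(i, a)\<close> and the
  operations \<open>x(p\<^sub>i\<^sub>,\<^sub>j)\<close>, and in these terms every face map is reindexing along fibres of \<open>\<alpha>\<close>;
  functoriality then reduces to the composition law of the \<open>p\<^sub>i\<^sub>,\<^sub>j\<close>.
  A morphism of list nerves preserves shapes, because the list \<open>\<theta>\<^sup>*x\<close> has one entry for each element of
  level \<open>\<theta>(k)\<close>, so that the sizes of all levels and of all fibres are preserved. The 0-simplices are the
  colours, the 1-simplices are the operations, and every colour and every \<open>p\<^sub>i\<^sub>,\<^sub>j\<close> of a simplex is seen
  on a 0- or 1-dimensional face. Hence the morphism is given by a map of colours and a map of operations;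
  degenerate simplices show that these preserve units, and 2-simplices that they preserve composition.
\<close>

text \<open>A branch is renumbered to a chain of standard ordinals, so the simplicial identities
  must hold as equalities and not merely up to isomorphism of trees. The renumbering by
  \<open>inv_into\<close> is awkward to compose, and this is avoided. A branch is handled through
  the increasing enumerations of its levels, which embed it into the ambient chain and carry fibres
  to fibres; two chains are then identified by the sizes of their levels and fibres. Since fibres
  are strictly increasing lists, equality of lists of elements reduces to equality of sets. The main
  use of monotonicity is that the fibres over successive elements, concatenated, are again in
  increasing order: this one fact gives the inputs of composites, the composition law of the
  \<open>p\<^sub>i\<^sub>,\<^sub>j\<close>, and the concatenation law for lists of faces.\<close>

section \<open>Strictly increasing lists\<close>

lemma strict_sorted_filter_upt: "sorted_wrt (<) (filter Q [m..<n])"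
  by (intro sorted_wrt_filter) simp

text \<open>For \<open>b\<close> in an earlier block than \<open>c\<close>, \<open>c \<le> b\<close>
  would give \<open>f c \<le> f b\<close> by monotonicity, against the order of the blocks. The
  intended \<open>f\<close> is a link of a chain, with its fibres as blocks.\<close>

lemma strict_sorted_concat_map:
  fixes f :: "'b::linorder \<Rightarrow> 'a::linorder"
  assumes "sorted_wrt (<) xs" "\<And>x. x \<in> set xs \<Longrightarrow> sorted_wrt (<) (F x)"
    and "\<And>x b. x \<in> set xs \<Longrightarrow> b \<in> set (F x) \<Longrightarrow> b \<in> B \<and> f b = x"
    and "mono_on B f"
  shows "sorted_wrt (<) (concat (map F xs))"
  using assms(1-3)
proof (induction xs)
  case (Cons x xs)
  have "b < c" if "b \<in> set (F x)" "y \<in> set xs" "c \<in> set (F y)" for b y c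
  proof -
    have "x < y" "f b = x" "f c = y" "b \<in> B" "c \<in> B"
      using that Cons.prems by (auto simp del: not_less)
    then show ?thesis using mono_onD[OF assms(4), of c b] by force
  qed
  moreover have "sorted_wrt (<) (concat (map F xs))"
    using Cons.prems by (intro Cons.IH) auto
  ultimately show ?case using Cons.prems(2) by (auto simp: sorted_wrt_append)
qed simp

lemma strict_sorted_map:
  assumes "sorted_wrt (<) xs" "\<And>a b. a \<in> set xs \<Longrightarrow> b \<in> set xs \<Longrightarrow> a < b \<Longrightarrow> f a < f b"
  shows "sorted_wrt (<) (map f xs)"
  using assms by (induction xs) auto

lemma strict_sorted_eqI:
  fixes xs ys :: "'a::linorder list"
  assumes "sorted_wrt (<) xs" "sorted_wrt (<) ys" "set xs = set ys"
  shows "xs = ys"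
  using assms strict_sorted_equal by blast

section \<open>Chains\<close>

lemma link_refl [simp]: "link \<alpha> i i b = b"
  by (simp add: link_def)

lemma link_Suc: "i \<le> j \<Longrightarrow> link \<alpha> i (Suc j) b = step \<alpha> (Suc j) (link \<alpha> i j b)"
  by (simp add: link_def)

lemma link_link:
  assumes "i \<le> j" "j \<le> k"
  shows "link \<alpha> j k (link \<alpha> i j b) = link \<alpha> i k b"
  using assms(2,1) by (induction k rule: dec_induct) (auto simp: link_Suc)

lemma chains_step:
  assumes "\<alpha> \<in> chains n" "Suc i \<le> n"
  shows "step \<alpha> (Suc i) \<in> order_maps {..<level \<alpha> i} {..<level \<alpha> (Suc i)}"
proof -
  have "step \<alpha> \<in> (\<Pi>\<^sub>E i\<in>{1..n}. order_maps {..<level \<alpha> (i - 1)} {..<level \<alpha> i})"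
    using assms(1) by (simp add: chains_def)
  from PiE_mem[OF this, of "Suc i"] assms(2) show ?thesis by simp
qed

lemma chains_len: "\<alpha> \<in> chains n \<Longrightarrow> len \<alpha> = n"
  by (simp add: chains_def)

lemma link_less:
  assumes "\<alpha> \<in> chains n" "i \<le> j" "j \<le> n" "b < level \<alpha> i"
  shows "link \<alpha> i j b < level \<alpha> j"
  using assms(2,3)
proof (induction j rule: dec_induct)
  case (step j)
  with chains_step[OF assms(1), of j] show ?case
    by (auto simp: link_Suc order_maps_def)
qed (use assms(4) in simp)

lemma link_mono:
  assumes "\<alpha> \<in> chains n" "i \<le> j" "j \<le> n" "b \<le> c" "c < level \<alpha> i"
  shows "link \<alpha> i j b \<le> link \<alpha> i j c"
  using assms(2,3)
proof (induction j rule: dec_induct)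
  case (step j)
  with chains_step[OF assms(1), of j] link_less[OF assms(1), of i j b] link_less[OF assms(1), of i j c] assms(4,5)
  show ?case
    by (auto simp: link_Suc order_maps_def intro: mono_onD)
qed (use assms(4) in simp)

lemma set_fibre: "set (fibre \<alpha> i j a) = {b. b < level \<alpha> i \<and> link \<alpha> i j b = a}"
  by (auto simp: fibre_def)

lemma strict_sorted_fibre: "sorted_wrt (<) (fibre \<alpha> i j a)"
  by (simp add: fibre_def strict_sorted_filter_upt)

lemma fibre_nth:
  assumes "b < length (fibre \<alpha> i j a)"
  shows "fibre \<alpha> i j a ! b < level \<alpha> i" "link \<alpha> i j (fibre \<alpha> i j a ! b) = a"
  using nth_mem[OF assms] by (simp_all only: set_fibre mem_Collect_eq)

lemma fibre_refl: "a < level \<alpha> i \<Longrightarrow> fibre \<alpha> i i a = [a]"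
  by (rule strict_sorted_eqI[OF strict_sorted_fibre]) (auto simp: set_fibre)

text \<open>Both lists are strictly increasing, the left one because links are monotone, so
  comparing sets suffices. This is the combinatorial core of composing the
  \<open>p\<^sub>i\<^sub>,\<^sub>j\<close>: it merges the inputs of the factors into the inputs of
  the composite.\<close>

lemma concat_fibres:
  assumes "\<alpha> \<in> chains n" "i \<le> j" "j \<le> k" "k \<le> n"
  shows "concat (map (fibre \<alpha> i j) (fibre \<alpha> j k a)) = fibre \<alpha> i k a"
proof (rule strict_sorted_eqI[OF _ strict_sorted_fibre])
  show "sorted_wrt (<) (concat (map (fibre \<alpha> i j) (fibre \<alpha> j k a)))"
    by (rule strict_sorted_concat_map[where f = "link \<alpha> i j" and B = "{..<level \<alpha> i}"])
      (use assms in \<open>auto simp: strict_sorted_fibre set_fibre intro!: mono_onI link_mono[OF assms(1)]\<close>)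
  show "set (concat (map (fibre \<alpha> i j) (fibre \<alpha> j k a))) = set (fibre \<alpha> i k a)"
    using assms by (auto simp: set_fibre link_link link_less[OF assms(1)])
qed

text \<open>The fibres of a monotone map cut its domain into consecutive intervals. This is behind
  both the recovery of a chain from fibre sizes and the concatenation law for face maps.\<close>

lemma concat_fibres_all:
  assumes "\<alpha> \<in> chains n" "i \<le> j" "j \<le> n"
  shows "concat (map (fibre \<alpha> i j) [0..<level \<alpha> j]) = [0..<level \<alpha> i]"
proof (rule strict_sorted_eqI)
  show "sorted_wrt (<) (concat (map (fibre \<alpha> i j) [0..<level \<alpha> j]))"
    by (rule strict_sorted_concat_map[where f = "link \<alpha> i j" and B = "{..<level \<alpha> i}"])
      (use assms in \<open>auto simp: strict_sorted_fibre set_fibre intro!: mono_onI link_mono[OF assms(1)]\<close>)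
  show "set (concat (map (fibre \<alpha> i j) [0..<level \<alpha> j])) = set [0..<level \<alpha> i]"
    using assms by (auto simp: set_fibre link_less[OF assms(1)])
qed simp

lemma fibre_rooted:
  assumes "\<alpha> \<in> chains n" "rooted \<alpha>" "i \<le> n"
  shows "fibre \<alpha> i n 0 = [0..<level \<alpha> i]"
  using concat_fibres_all[OF assms(1,3) order_refl] assms by (simp add: rooted_def chains_len)

text \<open>A monotone map of finite ordinals is determined by the sizes of its fibres.\<close>

lemma chain_eqI:
  assumes \<alpha>: "\<alpha> \<in> chains n" and \<beta>: "\<beta> \<in> chains n"
    and lev: "\<And>i. i \<le> n \<Longrightarrow> level \<alpha> i = level \<beta> i"
    and fib: "\<And>i a. Suc i \<le> n \<Longrightarrow> a < level \<alpha> (Suc i)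
      \<Longrightarrow> length (fibre \<alpha> i (Suc i) a) = length (fibre \<beta> i (Suc i) a)"
  shows "\<alpha> = \<beta>"
proof -
  have "fibre \<alpha> i (Suc i) a = fibre \<beta> i (Suc i) a" if "Suc i \<le> n" "a < level \<alpha> (Suc i)" for i a
  proof -
    let ?m = "level \<alpha> (Suc i)"
    let ?A = "map (fibre \<alpha> i (Suc i)) [0..<?m]" and ?B = "map (fibre \<beta> i (Suc i)) [0..<?m]"
    \<comment> \<open>The same list cut into blocks of the same lengths has the same blocks.\<close>
    have "concat ?A = concat ?B"
      using concat_fibres_all[OF \<alpha>, of i "Suc i"] concat_fibres_all[OF \<beta>, of i "Suc i"] that lev
      by simp
    moreover have "length x = length y" if "(x, y) \<in> set (zip ?A ?B)" for x y
      using that fib \<open>Suc i \<le> n\<close> by (auto simp: zip_map_map zip_same_conv_map)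
    ultimately have "?A = ?B" by (intro concat_injective) auto
    then show ?thesis using that by (auto simp: map_eq_conv)
  qed
  then have fib': "set (fibre \<alpha> i (Suc i) a) = set (fibre \<beta> i (Suc i) a)"
    if "Suc i \<le> n" "a < level \<alpha> (Suc i)" for i a using that by simp
  \<comment> \<open>The value of a step at \<open>b\<close> is read off from the fibre containing
    \<open>b\<close>.\<close>
  have "step \<alpha> (Suc i) b = step \<beta> (Suc i) b" if "Suc i \<le> n" "b < level \<alpha> i" for i b
  proof -
    let ?a = "step \<alpha> (Suc i) b"
    have "?a < level \<alpha> (Suc i)" using link_less[OF \<alpha>, of i "Suc i" b] that by (simp add: link_Suc)
    moreover have "b \<in> set (fibre \<alpha> i (Suc i) ?a)" using that by (simp add: set_fibre link_Suc)
    ultimately have "b \<in> set (fibre \<beta> i (Suc i) ?a)" using fib' that(1) by blast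
    then show ?thesis by (simp add: set_fibre link_Suc)
  qed
  then have "step \<alpha> (Suc i) = step \<beta> (Suc i)" if "Suc i \<le> n" for i
    using chains_step[OF \<alpha> that] chains_step[OF \<beta> that] that lev[of i]
    by (intro extensionalityI[where A = "{..<level \<alpha> i}"]) (simp_all add: order_maps_def PiE_def)
  then have "step \<alpha> i = step \<beta> i" if "i \<in> {1..n}" for i
    using that by (cases i) auto
  then have "step \<alpha> = step \<beta>"
    using \<alpha> \<beta> by (auto simp: chains_def PiE_def intro: extensionalityI[where A = "{1..n}"])
  moreover have "level \<alpha> = level \<beta>"
    using \<alpha> \<beta> lev by (intro extensionalityI[where A = "{..n}"]) (auto simp: chains_def)
  ultimately show ?thesis using chains_len[OF \<alpha>] chains_len[OF \<beta>] by simp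
qed

section \<open>Pullbacks and branches of chains\<close>

text \<open>Shaped like the right-hand sides of \<open>pullback\<close> and \<open>branch\<close>.
  Writing the index as \<open>Suc i\<close> frees the conditions to be checked from the subtraction
  \<open>i - 1\<close>.\<close>

lemma chainsI:
  assumes "\<And>i b. Suc i \<le> n \<Longrightarrow> b < l i \<Longrightarrow> s (Suc i) b < l (Suc i)"
    and "\<And>i b c. Suc i \<le> n \<Longrightarrow> b \<le> c \<Longrightarrow> c < l i \<Longrightarrow> s (Suc i) b \<le> s (Suc i) c"
  shows "\<lparr>len = n, level = (\<lambda>i\<in>{..n}. l i), step = (\<lambda>i\<in>{1..n}. \<lambda>b\<in>{..<l (i - 1)}. s i b)\<rparr> \<in> chains n"
proof -
  have "(\<lambda>b\<in>{..<l (i - 1)}. s i b) \<in> order_maps {..<l (i - 1)} {..<l i}" if "1 \<le> i" "i \<le> n" for i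
    using that assms[of "i - 1"] by (auto simp: order_maps_def intro!: mono_onI)
  then show ?thesis by (auto simp: chains_def)
qed

lemma pullback_chains:
  assumes "\<alpha> \<in> chains n" "\<theta> \<in> order_maps {..k} {..n}"
  shows "pullback k \<theta> \<alpha> \<in> chains k"
proof -
  have "\<theta> i \<le> \<theta> (Suc i)" "\<theta> (Suc i) \<le> n" if "Suc i \<le> k" for i
    using that assms(2) by (auto simp: order_maps_def intro: mono_onD)
  then show ?thesis unfolding pullback_def
    by (intro chainsI) (auto intro: link_less link_mono assms(1))
qed

lemma order_maps_le:
  assumes "\<theta> \<in> order_maps {..k} {..n}" 
  shows "i \<le> k \<Longrightarrow> \<theta> i \<le> n" "i \<le> j \<Longrightarrow> j \<le> k \<Longrightarrow> \<theta> i \<le> \<theta> j"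
  using assms by (auto simp: order_maps_def intro: mono_onD)

lemma level_pullback: "i \<le> k \<Longrightarrow> level (pullback k \<theta> \<alpha>) i = level \<alpha> (\<theta> i)"
  by (simp add: pullback_def)

lemma len_pullback [simp]: "len (pullback k \<theta> \<alpha>) = k"
  by (simp add: pullback_def)

lemma link_pullback:
  assumes "\<alpha> \<in> chains n" "\<theta> \<in> order_maps {..k} {..n}" "i \<le> j" "j \<le> k" "b < level \<alpha> (\<theta> i)"
  shows "link (pullback k \<theta> \<alpha>) i j b = link \<alpha> (\<theta> i) (\<theta> j) b"
  using assms(3,4)
proof (induction j rule: dec_induct)
  case (step j)
  then have le: "\<theta> i \<le> \<theta> j" "\<theta> j \<le> \<theta> (Suc j)" "\<theta> j \<le> n"
    using order_maps_le[OF assms(2)] by auto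
  with step link_less[OF assms(1), of "\<theta> i" "\<theta> j" b] assms(5) show ?case
    by (simp add: link_Suc pullback_def link_link)
qed simp

lemma fibre_pullback:
  assumes "\<alpha> \<in> chains n" "\<theta> \<in> order_maps {..k} {..n}" "i \<le> j" "j \<le> k"
  shows "fibre (pullback k \<theta> \<alpha>) i j a = fibre \<alpha> (\<theta> i) (\<theta> j) a"
  using assms by (auto simp: fibre_def level_pullback link_pullback[OF assms] intro!: filter_cong)

lemma level_branch: "i \<le> len \<alpha> \<Longrightarrow> level (branch \<alpha> a) i = length (fibre \<alpha> i (len \<alpha>) a)"
  by (simp add: branch_def Let_def)

lemma len_branch [simp]: "len (branch \<alpha> a) = len \<alpha>"
  by (simp add: branch_def Let_def)

lemma distinct_fibre: "distinct (fibre \<alpha> i j a)"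
  by (simp add: fibre_def)

lemma fibre_nth_less_iff:
  assumes "b < length (fibre \<alpha> i j a)" "c < length (fibre \<alpha> i j a)"
  shows "fibre \<alpha> i j a ! b < fibre \<alpha> i j a ! c \<longleftrightarrow> b < c"
  using sorted_wrt_nth_less[OF strict_sorted_fibre, of b c \<alpha> i j a]
    sorted_wrt_nth_less[OF strict_sorted_fibre, of c b \<alpha> i j a] assms
  by (metis linorder_neqE_nat order_less_asym)

text \<open>A step maps elements over \<open>a\<close> to elements over \<open>a\<close>, because
  links compose; hence the \<open>inv_into\<close> in \<open>branch\<close> is taken at a point of
  the fibre and is a genuine inverse there. Later facts on the steps of a branch come from these two
  conclusions.\<close>

lemma step_branch:
  assumes "\<alpha> \<in> chains n" "Suc i \<le> n" "b < length (fibre \<alpha> i n a)"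
  shows "step (branch \<alpha> a) (Suc i) b < length (fibre \<alpha> (Suc i) n a)"
    and "fibre \<alpha> (Suc i) n a ! step (branch \<alpha> a) (Suc i) b = step \<alpha> (Suc i) (fibre \<alpha> i n a ! b)"
proof -
  let ?L = "fibre \<alpha> (Suc i) n a" and ?y = "step \<alpha> (Suc i) (fibre \<alpha> i n a ! b)"
  have "?y = link \<alpha> i (Suc i) (fibre \<alpha> i n a ! b)" by (simp add: link_Suc)
  then have "?y \<in> set ?L"
    using fibre_nth[OF assms(3)] assms by (simp add: set_fibre link_link link_less[OF assms(1)])
  then have "?y \<in> (!) ?L ` {..<length ?L}" by (metis image_eqI in_set_conv_nth lessThan_iff)
  from inv_into_into[OF this] f_inv_into_f[OF this] assms
  show "step (branch \<alpha> a) (Suc i) b < length ?L" "?L ! step (branch \<alpha> a) (Suc i) b = ?y"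
    by (simp_all add: branch_def Let_def chains_len)
qed

lemma branch_chains:
  assumes "\<alpha> \<in> chains n"
  shows "branch \<alpha> a \<in> chains n"
proof -
  let ?\<phi> = "\<lambda>i. fibre \<alpha> i n a"
  let ?s = "\<lambda>i b. inv_into {..<length (?\<phi> i)} ((!) (?\<phi> i)) (step \<alpha> i (?\<phi> (i - 1) ! b))"
  have s: "?s (Suc i) b = step (branch \<alpha> a) (Suc i) b" if "Suc i \<le> n" "b < length (?\<phi> i)" for i b
    using that assms by (simp add: branch_def Let_def chains_len)
  have "?s (Suc i) b \<le> ?s (Suc i) c" if "Suc i \<le> n" "b \<le> c" "c < length (?\<phi> i)" for i b c
  proof -
    \<comment> \<open>Monotonicity is checked inside \<alpha>, since the enumerations of the fibres
      preserve and reflect the order.\<close>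
    have "link \<alpha> i (Suc i) (?\<phi> i ! b) \<le> link \<alpha> i (Suc i) (?\<phi> i ! c)"
      using that fibre_nth(1)[OF that(3)] fibre_nth_less_iff[of c \<alpha> i n a b]
      by (intro link_mono[OF assms]) auto
    moreover have b: "b < length (?\<phi> i)" using that by simp
    ultimately show ?thesis
      using step_branch[OF assms that(1,3)] step_branch[OF assms that(1) b]
        fibre_nth_less_iff[of "step (branch \<alpha> a) (Suc i) c" \<alpha> "Suc i" n a "step (branch \<alpha> a) (Suc i) b"]
      unfolding s[OF that(1,3)] s[OF that(1) b] by (simp add: link_Suc not_less[symmetric])
  qed
  moreover have "?s (Suc i) b < length (?\<phi> (Suc i))" if "Suc i \<le> n" "b < length (?\<phi> i)" for i b
    using step_branch(1)[OF assms that] s[OF that] by simp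
  ultimately have "\<lparr>len = n, level = (\<lambda>i\<in>{..n}. length (?\<phi> i)),
      step = (\<lambda>i\<in>{1..n}. \<lambda>b\<in>{..<length (?\<phi> (i - 1))}. ?s i b)\<rparr> \<in> chains n"
    by (intro chainsI) auto
  then show ?thesis using assms by (simp add: branch_def Let_def chains_len)
qed

lemma branch_rooted: "a < level \<alpha> (len \<alpha>) \<Longrightarrow> rooted (branch \<alpha> a)"
  by (simp add: rooted_def level_branch fibre_refl)

lemma link_branch:
  assumes "\<alpha> \<in> chains n" "i \<le> j" "j \<le> n" "b < length (fibre \<alpha> i n a)"
  shows "fibre \<alpha> j n a ! link (branch \<alpha> a) i j b = link \<alpha> i j (fibre \<alpha> i n a ! b)"
  using assms(2,3)
proof (induction j rule: dec_induct)
  case (step j)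
  moreover have "link (branch \<alpha> a) i j b < length (fibre \<alpha> j n a)"
    using link_less[OF branch_chains[OF assms(1)], of i j b a] step assms
    by (simp add: level_branch chains_len)
  ultimately show ?case
    using step_branch(2)[OF assms(1), of j "link (branch \<alpha> a) i j b" a] by (simp add: link_Suc)
qed simp

text \<open>Whatever lies over an element that lies over \<open>a\<close> lies itself over
  \<open>a\<close>, so passing to the branch loses nothing of the fibre. The enumeration is
  increasing, hence comparing sets suffices.\<close>

lemma fibre_branch:
  assumes "\<alpha> \<in> chains n" "i \<le> j" "j \<le> n" "b < length (fibre \<alpha> j n a)"
  shows "map ((!) (fibre \<alpha> i n a)) (fibre (branch \<alpha> a) i j b) = fibre \<alpha> i j (fibre \<alpha> j n a ! b)"
proof (rule strict_sorted_eqI[OF strict_sorted_map[OF strict_sorted_fibre] strict_sorted_fibre])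
  note [simp] = level_branch chains_len[OF assms(1)]
  show "fibre \<alpha> i n a ! c < fibre \<alpha> i n a ! d"
    if "c \<in> set (fibre (branch \<alpha> a) i j b)" "d \<in> set (fibre (branch \<alpha> a) i j b)" "c < d" for c d
    using that assms(2,3) by (simp add: set_fibre fibre_nth_less_iff)
  show "set (map ((!) (fibre \<alpha> i n a)) (fibre (branch \<alpha> a) i j b)) = set (fibre \<alpha> i j (fibre \<alpha> j n a ! b))"
  proof (intro equalityI subsetI)
    fix d assume "d \<in> set (map ((!) (fibre \<alpha> i n a)) (fibre (branch \<alpha> a) i j b))"
    then obtain c where c: "c < length (fibre \<alpha> i n a)" "link (branch \<alpha> a) i j c = b" "d = fibre \<alpha> i n a ! c"
      using assms(2,3) by (auto simp: set_fibre)
    with fibre_nth[OF c(1)] link_branch[OF assms(1-3) c(1)]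
    show "d \<in> set (fibre \<alpha> i j (fibre \<alpha> j n a ! b))" by (simp add: set_fibre)
  next
    fix d assume "d \<in> set (fibre \<alpha> i j (fibre \<alpha> j n a ! b))"
    then have d: "d < level \<alpha> i" "link \<alpha> i j d = fibre \<alpha> j n a ! b" by (auto simp: set_fibre)
    then have "link \<alpha> i n d = a" using fibre_nth(2)[OF assms(4)] link_link[OF assms(2,3)] by metis
    with d have "d \<in> set (fibre \<alpha> i n a)" by (simp add: set_fibre)
    then obtain c where c: "c < length (fibre \<alpha> i n a)" "d = fibre \<alpha> i n a ! c"
      by (auto simp: in_set_conv_nth)
    have "link (branch \<alpha> a) i j c < length (fibre \<alpha> j n a)"
      using link_less[OF branch_chains[OF assms(1)], of i j c a] assms(2,3) c by simp
    then have "link (branch \<alpha> a) i j c = b"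
      using link_branch[OF assms(1-3) c(1)] d(2) c(2) assms(4) nth_eq_iff_index_eq[OF distinct_fibre]
      by metis
    with c assms(2,3) show "d \<in> set (map ((!) (fibre \<alpha> i n a)) (fibre (branch \<alpha> a) i j b))"
      by (auto simp: set_fibre)
  qed
qed

lemma order_maps_compose:
  assumes "\<theta> \<in> order_maps {..m} {..n}" "\<psi> \<in> order_maps {..k} {..m}"
  shows "compose {..k} \<theta> \<psi> \<in> order_maps {..k} {..n}"
  using order_maps_le[OF assms(1)] order_maps_le[OF assms(2)]
  by (auto simp: order_maps_def compose_def intro!: mono_onI)

text \<open>Enumerating in two stages, once for each restriction, gives the enumeration of the
  single restriction along the composite map. It is \<open>fibre_branch\<close> for \<beta>, read at
  the levels selected by \<psi>.\<close>

lemma fibre_face_face: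
  assumes \<alpha>: "\<alpha> \<in> chains n" and \<theta>: "\<theta> \<in> order_maps {..m} {..n}" and \<psi>: "\<psi> \<in> order_maps {..k} {..m}"
    and \<beta>: "\<beta> = pullback m \<theta> \<alpha>" and a: "a < length (fibre \<beta> (\<psi> k) m b)" and i: "i \<le> k"
  shows "map ((!) (fibre \<beta> (\<psi> i) m b)) (fibre (pullback k \<psi> (branch \<beta> b)) i k a)
    = fibre (pullback k (compose {..k} \<theta> \<psi>) \<alpha>) i k (fibre \<beta> (\<psi> k) m b ! a)"
proof -
  have \<beta>': "\<beta> \<in> chains m" unfolding \<beta> by (rule pullback_chains[OF \<alpha> \<theta>])
  have b: "branch \<beta> b \<in> chains m" by (rule branch_chains[OF \<beta>'])
  have \<chi>: "compose {..k} \<theta> \<psi> \<in> order_maps {..k} {..n}" by (rule order_maps_compose[OF \<theta> \<psi>])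
  note le = order_maps_le[OF \<psi>]
  show ?thesis
    using fibre_branch[OF \<beta>' le(2)[OF i order_refl] le(1)[OF order_refl] a] i le
    by (simp add: fibre_pullback[OF b[unfolded \<beta>] \<psi>] fibre_pullback[OF \<alpha> \<chi>] \<beta> fibre_pullback[OF \<alpha> \<theta>] compose_eq)
qed

text \<open>Both sides restrict to the same elements of \<alpha>, enumerated in two stages or in
  one. The sizes of levels and fibres therefore agree, and \<open>chain_eqI\<close> spares any
  comparison of the renumbered steps.\<close>

lemma branch_pullback_branch:
  assumes \<alpha>: "\<alpha> \<in> chains n" and \<theta>: "\<theta> \<in> order_maps {..m} {..n}" and \<psi>: "\<psi> \<in> order_maps {..k} {..m}"
    and \<beta>: "\<beta> = pullback m \<theta> \<alpha>" and a: "a < length (fibre \<beta> (\<psi> k) m b)"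
  shows "branch (pullback k \<psi> (branch \<beta> b)) a
    = branch (pullback k (compose {..k} \<theta> \<psi>) \<alpha>) (fibre \<beta> (\<psi> k) m b ! a)"
proof (rule chain_eqI)
  let ?\<gamma> = "pullback k \<psi> (branch \<beta> b)" and ?a = "fibre \<beta> (\<psi> k) m b ! a"
    and ?\<chi> = "compose {..k} \<theta> \<psi>"
  let ?\<delta> = "pullback k ?\<chi> \<alpha>"
  have \<beta>': "\<beta> \<in> chains m" unfolding \<beta> by (rule pullback_chains[OF \<alpha> \<theta>])
  have b: "branch \<beta> b \<in> chains m" by (rule branch_chains[OF \<beta>'])
  have \<gamma>: "?\<gamma> \<in> chains k" by (rule pullback_chains[OF b \<psi>])
  have \<chi>: "?\<chi> \<in> order_maps {..k} {..n}" by (rule order_maps_compose[OF \<theta> \<psi>])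
  have \<delta>: "?\<delta> \<in> chains k" by (rule pullback_chains[OF \<alpha> \<chi>])
  note le = order_maps_le[OF \<psi>]
  note emb = fibre_face_face[OF \<alpha> \<theta> \<psi> \<beta> a]
  show "branch ?\<gamma> a \<in> chains k" "branch ?\<delta> ?a \<in> chains k"
    using branch_chains \<gamma> \<delta> by blast+
  show lev: "level (branch ?\<gamma> a) i = level (branch ?\<delta> ?a) i" if "i \<le> k" for i
    using arg_cong[OF emb[OF that], of length] that by (simp add: level_branch)
  fix i c assume i: "Suc i \<le> k" and "c < level (branch ?\<gamma> a) (Suc i)"
  then have c: "c < length (fibre ?\<gamma> (Suc i) k a)" "c < length (fibre ?\<delta> (Suc i) k ?a)"
    using lev[OF i] by (simp_all add: level_branch)
  let ?d = "fibre ?\<gamma> (Suc i) k a ! c"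
  \<comment> \<open>Position \<open>c\<close> stands for the same element on both sides, so both
    fibres below it can be traced to one fibre of \<alpha>.\<close>
  have d: "fibre ?\<delta> (Suc i) k ?a ! c = fibre \<beta> (\<psi> (Suc i)) m b ! ?d"
    using nth_map[OF c(1), of "(!) (fibre \<beta> (\<psi> (Suc i)) m b)"] emb[OF i] by simp
  have "length (fibre (branch ?\<gamma> a) i (Suc i) c) = length (fibre ?\<gamma> i (Suc i) ?d)"
    using arg_cong[OF fibre_branch[OF \<gamma> _ i c(1)], of i length] by simp
  also have "\<dots> = length (fibre (branch \<beta> b) (\<psi> i) (\<psi> (Suc i)) ?d)"
    using i by (simp add: fibre_pullback[OF b \<psi>])
  also have "\<dots> = length (fibre \<beta> (\<psi> i) (\<psi> (Suc i)) (fibre \<beta> (\<psi> (Suc i)) m b ! ?d))"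
    using arg_cong[OF fibre_branch[OF \<beta>', of "\<psi> i" "\<psi> (Suc i)" ?d b], of length]
      fibre_nth(1)[OF c(1)] i le by (simp add: level_pullback level_branch chains_len[OF \<beta>'])
  also have "\<dots> = length (fibre ?\<delta> i (Suc i) (fibre ?\<delta> (Suc i) k ?a ! c))"
    unfolding d using i le by (simp add: \<beta> fibre_pullback[OF \<alpha> \<theta>] fibre_pullback[OF \<alpha> \<chi>] compose_eq)
  also have "\<dots> = length (fibre (branch ?\<delta> ?a) i (Suc i) c)"
    using arg_cong[OF fibre_branch[OF \<delta> _ i c(2)], of i length] by simp
  finally show "length (fibre (branch ?\<gamma> a) i (Suc i) c) = length (fibre (branch ?\<delta> ?a) i (Suc i) c)" .
qed

section \<open>Maps of operads\<close>

lemma op_homD: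
  assumes "x \<in> op_hom P Q"
  shows "fst x \<in> colours P \<rightarrow>\<^sub>E colours Q" "snd x \<in> operations P \<rightarrow>\<^sub>E operations Q"
    and "p \<in> operations P \<Longrightarrow> inputs Q (snd x p) = map (fst x) (inputs P p)"
    and "p \<in> operations P \<Longrightarrow> target Q (snd x p) = fst x (target P p)"
    and "c \<in> colours P \<Longrightarrow> snd x (op_unit P c) = op_unit Q (fst x c)"
    and "composable P p qs \<Longrightarrow> snd x (op_comp P p qs) = op_comp Q (snd x p) (map (snd x) qs)"
  using assms by (auto simp: op_hom_def)

lemma op_homI:
  assumes "f \<in> colours P \<rightarrow>\<^sub>E colours Q" "g \<in> operations P \<rightarrow>\<^sub>E operations Q"
    and "\<And>p. p \<in> operations P \<Longrightarrow> inputs Q (g p) = map f (inputs P p)"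
    and "\<And>p. p \<in> operations P \<Longrightarrow> target Q (g p) = f (target P p)"
    and "\<And>c. c \<in> colours P \<Longrightarrow> g (op_unit P c) = op_unit Q (f c)"
    and "\<And>p qs. composable P p qs \<Longrightarrow> g (op_comp P p qs) = op_comp Q (g p) (map g qs)"
  shows "(f, g) \<in> op_hom P Q"
  using assms by (auto simp: op_hom_def)

lemma op_hom_in:
  assumes "x \<in> op_hom P Q"
  shows "c \<in> colours P \<Longrightarrow> fst x c \<in> colours Q" "p \<in> operations P \<Longrightarrow> snd x p \<in> operations Q"
  using op_homD(1,2)[OF assms] by auto

lemma op_hom_composable:
  assumes "x \<in> op_hom P Q" "composable P p qs"
  shows "composable Q (snd x p) (map (snd x) qs)"
proof -
  have p: "p \<in> operations P" and qs: "set qs \<subseteq> operations P" and t: "map (target P) qs = inputs P p"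
    using assms(2) by (auto simp: composable_def)
  have "map (target Q) (map (snd x) qs) = map (fst x) (map (target P) qs)"
    using qs op_homD(4)[OF assms(1)] by auto
  then show ?thesis
    using op_hom_in(2)[OF assms(1)] op_homD(3)[OF assms(1) p] p qs t by (auto simp: composable_def)
qed

lemma op_hom_comp_in:
  assumes "operad P" "x \<in> op_hom P Q" "y \<in> op_hom Q R"
  shows "op_hom_comp P y x \<in> op_hom P R"
proof -
  interpret operad P by fact
  have comp: "p \<in> operations P \<and> set qs \<subseteq> operations P \<and> op_comp P p qs \<in> operations P"
    if "composable P p qs" for p qs
    using that comp_in by (auto simp: composable_def)
  note hx = op_homD[OF assms(2)] and hy = op_homD[OF assms(3)]
  have inp: "set (inputs P p) \<subseteq> colours P" if "p \<in> operations P" for p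
    using inputs_in[OF that] .
  have map: "map (compose A f g) xs = map f (map g xs)" if "set xs \<subseteq> A"
    for A xs and f :: "'z \<Rightarrow> 'w" and g :: "'v \<Rightarrow> 'z"
    using that by (auto simp: compose_eq)
  show ?thesis
    unfolding op_hom_comp_def
    using hx(1,2) hy(1,2) op_hom_composable[OF assms(2)] comp
    by (intro op_homI funcset_compose)
      (auto simp: PiE_def Pi_def compose_eq hx hy op_hom_in[OF assms(2)] inp map target_in unit_in)
qed

lemma fst_op_hom_comp: "c \<in> colours P \<Longrightarrow> fst (op_hom_comp P y x) c = fst y (fst x c)"
  and snd_op_hom_comp: "p \<in> operations P \<Longrightarrow> snd (op_hom_comp P y x) p = snd y (snd x p)"
  by (simp_all add: op_hom_comp_def compose_eq)

lemma op_hom_eqI: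
  assumes "x \<in> op_hom P Q" "y \<in> op_hom P Q"
    and "\<And>c. c \<in> colours P \<Longrightarrow> fst x c = fst y c" "\<And>p. p \<in> operations P \<Longrightarrow> snd x p = snd y p"
  shows "x = y"
  using op_homD(1,2)[OF assms(1)] op_homD(1,2)[OF assms(2)] assms(3,4)
  by (auto simp: PiE_def intro!: prod_eqI intro: extensionalityI)

section \<open>Free operads\<close>

lemma chop_concat: "chop (map length xss) (concat xss) = xss"
  by (induction xss) auto

lemma concat_map_concat: "concat (map concat xsss) = concat (concat xsss)"
  by (induction xsss) auto

text \<open>\<open>chop\<close> cuts the grafted list at the leaf counts of the subtrees. If the
  list comes already cut into such blocks, grafting at a node is grafting block by block, and the
  arguments about nodes use this form.\<close>

lemma graft_Node_concat:
  assumes "list_all2 (\<lambda>t us. length us = length (leaves t)) ts uss"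
  shows "graft (Node g ts) (concat uss) = Node g (map2 graft ts uss)"
proof -
  have "map (\<lambda>t. length (leaves t)) ts = map length uss"
    using assms by (induction rule: list_all2_induct) auto
  moreover have "map2 (\<lambda>h us. h us) (map graft ts) uss = map2 graft ts uss"
    by (simp add: zip_map1 case_prod_unfold)
  ultimately show ?thesis by (simp add: chop_concat)
qed

lemma list_all2_concat_split:
  assumes "list_all2 R (concat xss) ys"
  shows "\<exists>yss. ys = concat yss \<and> list_all2 (list_all2 R) xss yss"
  using assms
proof (induction xss arbitrary: ys)
  case (Cons xs xss)
  then obtain us vs where "ys = us @ vs" "list_all2 R xs us" "list_all2 R (concat xss) vs"
    by (auto simp: list_all2_append1)
  moreover from Cons.IH[OF this(3)] obtain vss where "vs = concat vss" "list_all2 (list_all2 R) xss vss"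
    by blast
  ultimately show ?case by (intro exI[of _ "us # vss"]) simp
qed simp

lemma map2_concat:
  assumes "list_all2 (\<lambda>xs ys. length xs = length ys) xss yss"
  shows "map2 f (concat xss) (concat yss) = concat (map2 (map2 f) xss yss)"
  using assms by (induction rule: list_all2_induct) auto

context
  fixes C :: "'c set" and G :: "'g set" and src :: "'g \<Rightarrow> 'c list" and tgt :: "'g \<Rightarrow> 'c"
begin

private abbreviation (input) "F \<equiv> free_operad C G src tgt"
private abbreviation (input) "W \<equiv> wf_trees C G src tgt"

lemma composable_free: "composable F t us \<longleftrightarrow> t \<in> W \<and> set us \<subseteq> W \<and> map (root tgt) us = leaves t"
  by (simp add: composable_def free_operad_def)

lemma wf_Leaf_iff: "Leaf c \<in> W \<longleftrightarrow> c \<in> C"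
  by (auto intro: wf_trees.intros elim: wf_trees.cases)

lemma wf_Node_iff: "Node g ts \<in> W \<longleftrightarrow> g \<in> G \<and> set ts \<subseteq> W \<and> map (root tgt) ts = src g"
  by (auto intro: wf_trees.intros elim: wf_trees.cases)

text \<open>The leaves of a node are the concatenated leaves of its subtrees, so a list matching
  them splits into one matching list per subtree. This prepares the inductions on trees.\<close>

lemma composable_Node:
  assumes "composable F (Node g ts) us"
  obtains uss where "us = concat uss" "list_all2 (composable F) ts uss"
    "graft (Node g ts) us = Node g (map2 graft ts uss)"
proof -
  have W: "set ts \<subseteq> W" "set us \<subseteq> W" "list_all2 (\<lambda>c u. root tgt u = c) (concat (map leaves ts)) us"
    using assms by (auto simp: composable_free wf_Node_iff list_all2_conv_all_nth list_eq_iff_nth_eq)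
  then obtain uss where uss: "us = concat uss"
      "list_all2 (list_all2 (\<lambda>c u. root tgt u = c)) (map leaves ts) uss"
    using list_all2_concat_split by blast
  have "map (root tgt) u = leaves t \<and> length u = length (leaves t)"
    if "list_all2 (\<lambda>c u. root tgt u = c) (leaves t) u" for t :: "('c, 'g) op_tree" and u
    using that by (auto simp: list_all2_conv_all_nth list_eq_iff_nth_eq)
  with uss(2) have *: "list_all2 (\<lambda>t u. map (root tgt) u = leaves t \<and> length u = length (leaves t)) ts uss"
    by (auto simp: list_all2_map1 elim!: list.rel_mono_strong)
  then have "list_all2 (composable F) ts uss"
    by (rule list.rel_mono_strong) (use W(1,2) uss(1) in \<open>auto simp: composable_free\<close>)
  moreover have "graft (Node g ts) us = Node g (map2 graft ts uss)"
    unfolding uss(1) using * by (intro graft_Node_concat) (auto elim: list_all2_mono)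
  ultimately show thesis using that uss(1) by blast
qed

lemma composable_Leaf:
  assumes "composable F (Leaf c) us"
  obtains u where "us = [u]" "u \<in> W" "root tgt u = c"
  using assms by (auto simp: composable_free)

lemma graft_wf:
  assumes "composable F t us"
  shows "graft t us \<in> W \<and> root tgt (graft t us) = root tgt t \<and> leaves (graft t us) = concat (map leaves us)"
  using assms
proof (induction t arbitrary: us)
  case (Leaf c)
  then show ?case by (elim composable_Leaf) simp
next
  case (Node g ts)
  from Node.prems obtain uss where uss: "us = concat uss" "list_all2 (composable F) ts uss"
    "graft (Node g ts) us = Node g (map2 graft ts uss)" by (rule composable_Node)
  have "list_all2 (\<lambda>t us. graft t us \<in> W \<and> root tgt (graft t us) = root tgt t
      \<and> leaves (graft t us) = concat (map leaves us)) ts uss"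
    using uss(2) by (rule list.rel_mono_strong) (use Node.IH in blast)
  then have "set (map2 graft ts uss) \<subseteq> W \<and> map (root tgt) (map2 graft ts uss) = map (root tgt) ts
      \<and> concat (map leaves (map2 graft ts uss)) = concat (map leaves (concat uss))"
    by (induction rule: list_all2_induct) auto
  then show ?case
    using Node.prems unfolding uss(3) by (simp add: uss(1) wf_Node_iff composable_free)
qed

text \<open>By induction on the innermost-rooted tree \<open>t\<close>. At a node both lists are cut
  into blocks belonging to its subtrees, associativity holds in each block, and the blocks are
  flattened again.\<close>

lemma graft_assoc:
  assumes "composable F t us" "list_all2 (composable F) us vss"
  shows "graft (graft t us) (concat vss) = graft t (map2 graft us vss)"
  using assms
proof (induction t arbitrary: us vss)
  case (Leaf c)
  then show ?case by (elim composable_Leaf) (auto simp: list_all2_Cons1)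
next
  case (Node g ts)
  from Node.prems(1) obtain uss where uss: "us = concat uss" "list_all2 (composable F) ts uss"
    "graft (Node g ts) us = Node g (map2 graft ts uss)" by (rule composable_Node)
  \<comment> \<open>The cut of \<open>us\<close> into blocks \<open>uss\<close> induces a cut of
    \<open>vss\<close>, one block of lists for each subtree.\<close>
  from Node.prems(2) obtain vsss where vss: "vss = concat vsss" "list_all2 (list_all2 (composable F)) uss vsss"
    unfolding uss(1) using list_all2_concat_split by blast
  have len: "length uss = length ts" "length vsss = length ts"
    using list_all2_lengthD[OF uss(2)] list_all2_lengthD[OF vss(2)] by auto
  have nth: "composable F (ts ! i) (uss ! i)" "list_all2 (composable F) (uss ! i) (vsss ! i)"
    "length (uss ! i) = length (vsss ! i)" if "i < length ts" for i
    using that uss(2) vss(2) len by (auto simp: list_all2_conv_all_nth)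
  have len_leaves: "length us = length (leaves t)" if "composable F t us" for t us
    using that by (metis composable_free length_map)
  \<comment> \<open>The leaf count of a grafted tree; it is needed to graft blockwise a second
    time.\<close>
  have len_concat: "length (concat vss) = length (leaves (graft t us))"
    if "composable F t us" "list_all2 (composable F) us vss" for t us vss
  proof -
    have "length (concat vss) = length (concat (map leaves us))"
      using that(2) by (induction rule: list_all2_induct) (simp_all add: len_leaves)
    then show ?thesis using graft_wf[OF that(1)] by simp
  qed
  have "graft (graft (Node g ts) us) (concat vss)
      = graft (Node g (map2 graft ts uss)) (concat (map concat vsss))"
    by (simp only: uss(3) vss(1) concat_map_concat)
  also have "\<dots> = Node g (map2 graft (map2 graft ts uss) (map concat vsss))"
    by (intro graft_Node_concat list_all2_all_nthI) (simp_all add: len len_concat[OF nth(1,2)])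
  also have "map2 graft (map2 graft ts uss) (map concat vsss) = map2 graft ts (map2 (map2 graft) uss vsss)"
    by (intro nth_equalityI) (auto simp: len nth intro!: Node.IH)
  also have "Node g \<dots> = graft (Node g ts) (concat (map2 (map2 graft) uss vsss))"
    by (intro graft_Node_concat[symmetric])
      (auto simp: list_all2_conv_all_nth len nth(3)[symmetric] intro!: len_leaves nth(1))
  also have "concat (map2 (map2 graft) uss vsss) = map2 graft us vss"
    unfolding uss(1) vss(1)
    by (intro map2_concat[symmetric]) (auto simp: list_all2_conv_all_nth len nth(3))
  finally show ?case .
qed

lemma root_leaves_in:
  assumes "\<And>g. g \<in> G \<Longrightarrow> tgt g \<in> C" "t \<in> W"
  shows "root tgt t \<in> C" "set (leaves t) \<subseteq> C"
  using assms(2) by (induction, auto simp: assms(1))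

lemma graft_units: "t \<in> W \<Longrightarrow> graft t (map Leaf (leaves t)) = t"
proof (induction rule: wf_trees.induct)
  case (Node g ts)
  have "graft (Node g ts) (concat (map (\<lambda>t. map Leaf (leaves t)) ts))
      = Node g (map2 graft ts (map (\<lambda>t. map Leaf (leaves t)) ts))"
    by (intro graft_Node_concat) (auto simp: list_all2_conv_all_nth)
  also have "map2 graft ts (map (\<lambda>t. map Leaf (leaves t)) ts) = ts"
    using Node by (intro nth_equalityI) auto
  finally show ?case by (simp add: map_concat comp_def)
qed simp

lemma free_operad_sel [simp]:
  "colours F = C" "operations F = W" "inputs F = leaves" "target F = root tgt"
  "op_unit F = Leaf" "op_comp F = graft"
  by (simp_all add: free_operad_def)

lemma operad_free:
  assumes "\<And>g. g \<in> G \<Longrightarrow> tgt g \<in> C"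
  shows "operad F"
  by (unfold_locales)
    (simp_all add: graft_wf graft_assoc graft_units wf_Leaf_iff root_leaves_in[OF assms])

text \<open>A generator enters the free operad as a single vertex with bare leaves. That its sources
  are colours is what makes these leaves admissible.\<close>

lemma corolla_wf:
  assumes "g \<in> G" "set (src g) \<subseteq> C"
  shows "Node g (map Leaf (src g)) \<in> W"
  using assms by (auto simp: wf_Node_iff wf_Leaf_iff comp_def)

section \<open>The universal property of the free operad\<close>

text \<open>Uniqueness: a node is the corolla of its label with its subtrees grafted on, so
  preservation of composition carries agreement from generators and colours to all trees.\<close>

lemma op_hom_free_eqI:
  assumes tgt: "\<And>g. g \<in> G \<Longrightarrow> tgt g \<in> C" and src: "\<And>g. g \<in> G \<Longrightarrow> set (src g) \<subseteq> C"
    and x: "x \<in> op_hom F P" and y: "y \<in> op_hom F P"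
    and C: "\<And>c. c \<in> C \<Longrightarrow> fst x c = fst y c"
    and G: "\<And>g. g \<in> G \<Longrightarrow> snd x (Node g (map Leaf (src g))) = snd y (Node g (map Leaf (src g)))"
  shows "x = y"
proof (rule op_hom_eqI[OF x y])
  have "snd x t = snd y t" if "t \<in> W" for t
    using that
  proof induction
    case (Leaf c)
    with op_homD(5)[OF x, of c] op_homD(5)[OF y, of c] C show ?case by simp
  next
    case (Node g ts)
    let ?t = "Node g (map Leaf (src g))"
    have comp: "composable F ?t ts"
      using Node corolla_wf src by (auto simp: composable_free comp_def)
    have len: "length (src g) = length ts" by (simp flip: Node(2))
    \<comment> \<open>Each leaf of the corolla receives a block consisting of a single
      subtree.\<close>
    have "graft ?t (concat (map (\<lambda>t. [t]) ts)) = Node g (map2 graft (map Leaf (src g)) (map (\<lambda>t. [t]) ts))"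
      by (intro graft_Node_concat) (auto simp: list_all2_conv_all_nth len)
    also have "map2 graft (map Leaf (src g)) (map (\<lambda>t. [t]) ts) = ts"
      using len by (intro nth_equalityI) auto
    finally have eq: "Node g ts = op_comp F ?t ts" by simp
    show ?case
      unfolding eq op_homD(6)[OF x comp] op_homD(6)[OF y comp] using Node(3) G[OF Node(1)]
      by (simp cong: map_cong)
  qed
  then show "snd x p = snd y p" if "p \<in> operations F" for p using that by simp
qed (use C in simp)

context
  fixes P :: "('d, 'p) operad" and f :: "'c \<Rightarrow> 'd" and h :: "'g \<Rightarrow> 'p"
  assumes P: "operad P" and f: "\<And>c. c \<in> C \<Longrightarrow> f c \<in> colours P"
    and h: "\<And>g. g \<in> G \<Longrightarrow> h g \<in> operations P \<and> inputs P (h g) = map f (src g) \<and> target P (h g) = f (tgt g)"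
begin

interpretation operad P by (rule P)

lemma eval_tree_in:
  assumes "t \<in> W"
  shows "eval_tree P f h t \<in> operations P \<and> inputs P (eval_tree P f h t) = map f (leaves t)
    \<and> target P (eval_tree P f h t) = f (root tgt t)"
  using assms
proof induction
  case (Leaf c)
  then show ?case using f by (simp add: unit_in inputs_unit target_unit)
next
  case (Node g ts)
  then have "map (target P) (map (eval_tree P f h) ts) = map f (src g)"
    unfolding Node(2)[symmetric] by auto
  then have "composable P (h g) (map (eval_tree P f h) ts)"
    using h[OF Node(1)] Node(3) by (auto simp: composable_def)
  then show ?case
    using h[OF Node(1)] Node(3) by (auto simp: comp_in inputs_comp target_comp map_concat comp_def intro!: arg_cong[of _ _ concat])
qed

lemma eval_tree_composable:
  assumes "composable F t us"
  shows "composable P (eval_tree P f h t) (map (eval_tree P f h) us)"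
proof -
  have "map (target P) (map (eval_tree P f h) us) = map f (map (root tgt) us)"
    using assms eval_tree_in unfolding composable_free map_map by (intro map_cong refl) auto
  also have "\<dots> = map f (leaves t)" using assms by (simp only: composable_free)
  finally show ?thesis using assms eval_tree_in by (auto simp: composable_free composable_def)
qed

text \<open>Preservation of composition, the main point of existence. At a leaf it is the left unit
  law of \<open>P\<close>, at a node it is associativity in \<open>P\<close> applied to the blocks
  of \<open>us\<close>.\<close>

lemma eval_tree_graft:
  assumes "composable F t us"
  shows "eval_tree P f h (graft t us) = op_comp P (eval_tree P f h t) (map (eval_tree P f h) us)"
  using assms
proof (induction t arbitrary: us)
  case (Leaf c)
  then obtain u where "us = [u]" "u \<in> W" "root tgt u = c" by (rule composable_Leaf)
  then show ?case using comp_unit_left eval_tree_in by fastforce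
next
  case (Node g ts)
  let ?e = "eval_tree P f h"
  from Node.prems obtain uss where uss: "us = concat uss" "list_all2 (composable F) ts uss"
    "graft (Node g ts) us = Node g (map2 graft ts uss)" by (rule composable_Node)
  have g: "g \<in> G" "set ts \<subseteq> W" "map (root tgt) ts = src g"
    using Node.prems by (auto simp: composable_free wf_Node_iff)
  have 1: "composable P (h g) (map ?e ts)"
    using h[OF g(1)] g(2) eval_tree_in by (auto simp: composable_def g(3)[symmetric])
  have 2: "list_all2 (composable P) (map ?e ts) (map (map ?e) uss)"
    using uss(2) by (auto simp: list_all2_map1 list_all2_map2 intro: eval_tree_composable elim: list_all2_mono)
  have "map ?e (map2 graft ts uss) = map2 (op_comp P) (map ?e ts) (map (map ?e) uss)"
    using uss(2) by (intro nth_equalityI) (auto simp: list_all2_conv_all_nth intro!: Node.IH)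
  then show ?case
    using comp_assoc[OF 1 2] unfolding uss(3) by (simp add: uss(1) map_concat)
qed

lemma eval_corolla:
  assumes "g \<in> G"
  shows "eval_tree P f h (Node g (map Leaf (src g))) = h g"
  using comp_unit_right[of "h g"] h[OF assms] by (simp add: comp_def)

lemma induced_hom_in:
  assumes "\<And>g. g \<in> G \<Longrightarrow> tgt g \<in> C"
  shows "induced_hom F P f h \<in> op_hom F P"
proof -
  note F = root_leaves_in[OF assms]
  have map: "map (restrict k A) xs = map k xs" if "set xs \<subseteq> A" for A xs and k :: "'z \<Rightarrow> 'w"
    using that by auto
  show ?thesis
    unfolding induced_hom_def
  proof (rule op_homI)
    fix t us assume c: "composable F t us"
    then have "t \<in> W" "set us \<subseteq> W" "graft t us \<in> W" using graft_wf[OF c] by (auto simp: composable_free)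
    then show "restrict (eval_tree P f h) (operations F) (op_comp F t us)
        = op_comp P (restrict (eval_tree P f h) (operations F) t) (map (restrict (eval_tree P f h) (operations F)) us)"
      using eval_tree_graft[OF c] by (simp add: map)
  qed (use f in \<open>auto simp: F map eval_tree_in wf_Leaf_iff\<close>)
qed

end

end

section \<open>Simplices of the list nerve\<close>

lemma tree_operad_sel [simp]:
  "op_unit (tree_operad \<alpha>) = Leaf" "op_comp (tree_operad \<alpha>) = graft"
  "colours (tree_operad \<alpha>) = {(i, a). i \<le> len \<alpha> \<and> a < level \<alpha> i}"
  "inputs (tree_operad \<alpha>) = leaves" "target (tree_operad \<alpha>) = root (\<lambda>(i, a). (i, a))"
  by (simp_all add: tree_operad_def)

lemma operad_tree: "operad (tree_operad \<alpha>)"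
  unfolding tree_operad_def by (rule operad_free) auto

text \<open>Generators live at positive levels while their sources are indexed by
  \<open>i - 1\<close>; splitting off a successor removes the truncated subtraction.\<close>

lemma tree_vertex_cases:
  obtains b where "g = (0 :: nat, b)" | i b where "g = (Suc i, b)"
  by (cases g) (metis not0_implies_Suc)

text \<open>The source function of \<open>tree_operad\<close> is left unevaluated so that the
  right-hand side matches the corollas in the facts on free operads.\<close>

lemma gen_eq_corolla:
  "gen \<alpha> (Suc i) a = Node (Suc i, a) (map Leaf ((\<lambda>(i, a). map (Pair (i - 1)) (fibre \<alpha> (i - 1) i a)) (Suc i, a)))"
  by (simp add: gen_def)

lemma gen_in:
  assumes "\<alpha> \<in> chains n" "Suc i \<le> n" "a < level \<alpha> (Suc i)"
  shows "gen \<alpha> (Suc i) a \<in> operations (tree_operad \<alpha>)"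
    and "inputs (tree_operad \<alpha>) (gen \<alpha> (Suc i) a) = map (Pair i) (fibre \<alpha> i (Suc i) a)"
    and "target (tree_operad \<alpha>) (gen \<alpha> (Suc i) a) = (Suc i, a)"
proof -
  show "gen \<alpha> (Suc i) a \<in> operations (tree_operad \<alpha>)"
    unfolding gen_eq_corolla tree_operad_def free_operad_sel
    using assms by (intro corolla_wf) (auto simp: set_fibre chains_len)
qed (simp_all add: gen_def comp_def)

lemma gen_comp_refl: "gen_comp \<alpha> i i a = op_unit (tree_operad \<alpha>) (i, a)"
  by (cases i) simp_all

lemma gen_comp_Suc: "i \<le> j \<Longrightarrow> gen_comp \<alpha> i (Suc j) a
    = op_comp (tree_operad \<alpha>) (gen \<alpha> (Suc j) a) (map (gen_comp \<alpha> i j) (fibre \<alpha> j (Suc j) a))"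
  by simp

declare gen_comp.simps [simp del]

lemma gen_composable:
  assumes "\<alpha> \<in> chains n" "Suc j \<le> n" "b < level \<alpha> (Suc j)"
    and "\<And>a. a < level \<alpha> j \<Longrightarrow> t a \<in> operations (tree_operad \<alpha>) \<and> target (tree_operad \<alpha>) (t a) = (j, a)"
  shows "composable (tree_operad \<alpha>) (gen \<alpha> (Suc j) b) (map t (fibre \<alpha> j (Suc j) b))"
  using assms(4) gen_in[OF assms(1-3)]
  by (auto simp: composable_def set_fibre simp del: tree_operad_sel cong: map_cong)

text \<open>By induction on the upper level. The inputs of the composite are concatenated fibres,
  which \<open>concat_fibres\<close> turns into a single fibre.\<close>

lemma gen_comp_in:
  assumes \<alpha>: "\<alpha> \<in> chains n" and "i \<le> j" "j \<le> n" "a < level \<alpha> j"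
  shows "gen_comp \<alpha> i j a \<in> operations (tree_operad \<alpha>)
      \<and> inputs (tree_operad \<alpha>) (gen_comp \<alpha> i j a) = map (Pair i) (fibre \<alpha> i j a)
      \<and> target (tree_operad \<alpha>) (gen_comp \<alpha> i j a) = (j, a)"
  using assms(2-4)
proof (induction j arbitrary: a rule: dec_induct)
  case base
  then have "(i, a) \<in> colours (tree_operad \<alpha>)" using chains_len[OF \<alpha>] by simp
  from operad.unit_in[OF operad_tree this] base(2) show ?case
    by (simp add: gen_comp_refl fibre_refl)
next
  case (step j)
  interpret T: operad "tree_operad \<alpha>" by (rule operad_tree)
  have IH: "gen_comp \<alpha> i j a \<in> operations (tree_operad \<alpha>)
      \<and> inputs (tree_operad \<alpha>) (gen_comp \<alpha> i j a) = map (Pair i) (fibre \<alpha> i j a)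
      \<and> target (tree_operad \<alpha>) (gen_comp \<alpha> i j a) = (j, a)" if "a < level \<alpha> j" for a
    using step that by simp
  have c: "composable (tree_operad \<alpha>) (gen \<alpha> (Suc j) a) (map (gen_comp \<alpha> i j) (fibre \<alpha> j (Suc j) a))"
    using IH step.prems by (intro gen_composable[OF \<alpha>]) auto
  have "map (inputs (tree_operad \<alpha>)) (map (gen_comp \<alpha> i j) (fibre \<alpha> j (Suc j) a))
      = map (map (Pair i)) (map (fibre \<alpha> i j) (fibre \<alpha> j (Suc j) a))"
    using IH by (auto simp: set_fibre simp del: tree_operad_sel)
  then have "concat (map (inputs (tree_operad \<alpha>)) (map (gen_comp \<alpha> i j) (fibre \<alpha> j (Suc j) a)))
      = map (Pair i) (fibre \<alpha> i (Suc j) a)"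
    using concat_fibres[OF \<alpha>, of i j "Suc j" a] step by (simp only: map_concat[symmetric])
  then show ?case
    unfolding gen_comp_Suc[OF step.hyps(1)]
    using T.comp_in[OF c] T.inputs_comp[OF c] T.target_comp[OF c] gen_in(3)[OF \<alpha> step.prems]
    by (simp only: simp_thms)
qed

section \<open>Simplices described by their labels\<close>

definition colr :: "('c, 'o) nerve_simplex \<Rightarrow> nat \<Rightarrow> nat \<Rightarrow> 'c" where
  "colr s i a = fst (snd s) (i, a)"

text \<open>Recorded for all pairs of levels and not only for consecutive ones: a face may skip
  levels, and its generators are then composites in the original simplex.\<close>

definition oper :: "('c, 'o) nerve_simplex \<Rightarrow> nat \<Rightarrow> nat \<Rightarrow> nat \<Rightarrow> 'o" where
  "oper s i j a = snd (snd s) (gen_comp (fst s) i j a)"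

lemma simplexD:
  assumes "s \<in> nerve_simplices P n"
  shows "fst s \<in> chains n" "rooted (fst s)" "snd s \<in> op_hom (tree_operad (fst s)) P"
    "len (fst s) = n" "level (fst s) n = 1"
  using assms by (auto simp: nerve_simplices_def chains_len rooted_def)

lemma simplexI:
  "\<alpha> \<in> chains n \<Longrightarrow> rooted \<alpha> \<Longrightarrow> x \<in> op_hom (tree_operad \<alpha>) P \<Longrightarrow> (\<alpha>, x) \<in> nerve_simplices P n"
  by (simp add: nerve_simplices_def)

context operad
begin

lemma colr_in:
  assumes "s \<in> nerve_simplices P n" "i \<le> n" "a < level (fst s) i"
  shows "colr s i a \<in> colours P"
  using op_hom_in(1)[OF simplexD(3)[OF assms(1)]] assms(2,3) simplexD(4)[OF assms(1)]
  by (simp add: colr_def)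

lemma oper_in:
  assumes "s \<in> nerve_simplices P n" "i \<le> j" "j \<le> n" "a < level (fst s) j"
  shows "oper s i j a \<in> operations P"
    and "inputs P (oper s i j a) = map (colr s i) (fibre (fst s) i j a)"
    and "target P (oper s i j a) = colr s j a"
  using op_hom_in(2)[OF simplexD(3)[OF assms(1)]] op_homD(3,4)[OF simplexD(3)[OF assms(1)]]
    gen_comp_in[OF simplexD(1)[OF assms(1)] assms(2-4)]
  by (simp_all add: colr_def oper_def comp_def del: tree_operad_sel)

lemma oper_refl:
  assumes "s \<in> nerve_simplices P n" "i \<le> n" "a < level (fst s) i"
  shows "oper s i i a = op_unit P (colr s i a)"
  using op_homD(5)[OF simplexD(3)[OF assms(1)], of "(i, a)"] assms(2,3) simplexD(4)[OF assms(1)]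
  by (simp add: colr_def oper_def gen_comp_refl)

lemma oper_Suc_gen:
  assumes "s \<in> nerve_simplices P n" "i \<le> j" "Suc j \<le> n" "a < level (fst s) (Suc j)"
  shows "oper s i (Suc j) a
    = op_comp P (snd (snd s) (gen (fst s) (Suc j) a)) (map (oper s i j) (fibre (fst s) j (Suc j) a))"
proof -
  have "composable (tree_operad (fst s)) (gen (fst s) (Suc j) a) (map (gen_comp (fst s) i j) (fibre (fst s) j (Suc j) a))"
    using gen_comp_in[OF simplexD(1)[OF assms(1)] assms(2)] assms(3)
    by (intro gen_composable[OF simplexD(1)[OF assms(1)] assms(3,4)]) auto
  from op_homD(6)[OF simplexD(3)[OF assms(1)] this] show ?thesis
    by (simp add: oper_def[abs_def] comp_def gen_comp_Suc[OF assms(2)] del: tree_operad_sel)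
qed

text \<open>Over one level \<open>gen_comp\<close> is a generator composed with units, so the right
  unit law of \<open>P\<close> removes them from its value.\<close>

lemma oper_step:
  assumes "s \<in> nerve_simplices P n" "Suc i \<le> n" "a < level (fst s) (Suc i)"
  shows "oper s i (Suc i) a = snd (snd s) (gen (fst s) (Suc i) a)"
proof -
  let ?p = "snd (snd s) (gen (fst s) (Suc i) a)"
  note g = gen_in[OF simplexD(1)[OF assms(1)] assms(2,3)]
  have p: "?p \<in> operations P" "inputs P ?p = map (colr s i) (fibre (fst s) i (Suc i) a)"
    using op_hom_in(2)[OF simplexD(3)[OF assms(1)]] op_homD(3)[OF simplexD(3)[OF assms(1)] g(1)] g
    by (simp_all add: colr_def comp_def del: tree_operad_sel)
  have "map (oper s i i) (fibre (fst s) i (Suc i) a) = map (op_unit P) (inputs P ?p)"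
    unfolding p(2) using assms by (auto simp: set_fibre oper_refl)
  then show ?thesis using oper_Suc_gen[OF assms(1) order_refl assms(2,3)] comp_unit_right[OF p(1)] by simp
qed

lemma oper_composable:
  assumes "s \<in> nerve_simplices P n" "i \<le> j" "j \<le> k" "k \<le> n" "a < level (fst s) k"
  shows "composable P (oper s j k a) (map (oper s i j) (fibre (fst s) j k a))"
  using assms by (auto simp: composable_def set_fibre oper_in)

text \<open>\<open>gen_comp\<close> only splits off its top level. Associativity in \<open>P\<close>
  moves the splitting point down to an arbitrary level \<open>j\<close>, by induction on
  \<open>k\<close>.\<close>

lemma oper_comp:
  assumes s: "s \<in> nerve_simplices P n" and ij: "i \<le> j" and "j \<le> k" "k \<le> n" "a < level (fst s) k"
  shows "oper s i k a = op_comp P (oper s j k a) (map (oper s i j) (fibre (fst s) j k a))"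
  using assms(3-5)
proof (induction k arbitrary: a rule: dec_induct)
  case base
  then show ?case
    using comp_unit_left[OF oper_in(1)[OF s ij]] oper_in(3)[OF s ij] by (simp add: oper_refl[OF s] fibre_refl)
next
  case (step k)
  let ?L = "fibre (fst s) k (Suc k) a"
  have Suc: "oper s m (Suc k) a = op_comp P (oper s k (Suc k) a) (map (oper s m k) ?L)" if "m \<le> k" for m
    using oper_Suc_gen[OF s that step.prems] oper_step[OF s step.prems] by simp
  have 1: "composable P (oper s k (Suc k) a) (map (oper s j k) ?L)"
    using step by (intro oper_composable[OF s]) auto
  have 2: "list_all2 (composable P) (map (oper s j k) ?L) (map (\<lambda>b. map (oper s i j) (fibre (fst s) j k b)) ?L)"
    using step ij by (auto simp: list_all2_conv_all_nth fibre_nth intro!: oper_composable[OF s])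
  have "oper s i (Suc k) a = op_comp P (oper s k (Suc k) a)
      (map (\<lambda>b. op_comp P (oper s j k b) (map (oper s i j) (fibre (fst s) j k b))) ?L)"
    using step ij by (subst Suc) (auto simp: set_fibre intro!: arg_cong[of _ _ "op_comp P _"])
  also have "\<dots> = op_comp P (oper s k (Suc k) a)
      (map2 (op_comp P) (map (oper s j k) ?L) (map (\<lambda>b. map (oper s i j) (fibre (fst s) j k b)) ?L))"
    by (simp add: zip_map_map zip_same_conv_map comp_def)
  also have "\<dots> = op_comp P (oper s j (Suc k) a)
      (concat (map (\<lambda>b. map (oper s i j) (fibre (fst s) j k b)) ?L))"
    using comp_assoc[OF 1 2] Suc[OF step.hyps(1)] by simp
  \<comment> \<open>The inner lists run over the fibres above which they sit, and these fibres
    concatenate to one.\<close>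
  also have "concat (map (\<lambda>b. map (oper s i j) (fibre (fst s) j k b)) ?L)
      = map (oper s i j) (fibre (fst s) j (Suc k) a)"
    unfolding concat_fibres[OF simplexD(1)[OF s] step.hyps(1) le_SucI[OF order_refl] step.prems(1), symmetric]
    by (simp add: map_concat comp_def)
  finally show ?case .
qed

text \<open>Uniqueness of maps out of the free operad, with the values on generators read as
  one-level composites by \<open>oper_step\<close>.\<close>

lemma simplex_eqI:
  assumes s: "s \<in> nerve_simplices P n" and t: "t \<in> nerve_simplices P n" and eq: "fst s = fst t"
    and C: "\<And>i a. i \<le> n \<Longrightarrow> a < level (fst s) i \<Longrightarrow> colr s i a = colr t i a"
    and O: "\<And>i a. Suc i \<le> n \<Longrightarrow> a < level (fst s) (Suc i) \<Longrightarrow> oper s i (Suc i) a = oper t i (Suc i) a"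
  shows "s = t"
proof (rule prod_eqI[OF eq])
  let ?\<alpha> = "fst s"
  have \<alpha>: "?\<alpha> \<in> chains n" "len ?\<alpha> = n" using simplexD[OF s] by auto
  have st: "snd s \<in> op_hom (tree_operad ?\<alpha>) P" "snd t \<in> op_hom (tree_operad ?\<alpha>) P"
    using simplexD(3)[OF s] simplexD(3)[OF t] eq by auto
  have gen: "snd (snd s) (gen ?\<alpha> (Suc i) a) = snd (snd t) (gen ?\<alpha> (Suc i) a)"
    if "Suc i \<le> n" "a < level ?\<alpha> (Suc i)" for i a
    using O[OF that] oper_step[OF s that] oper_step[OF t that(1)] that(2) eq by simp
  show "snd s = snd t"
  proof (rule op_hom_free_eqI[OF _ _ st[unfolded tree_operad_def]])
    fix g :: "nat \<times> nat" assume "g \<in> {(i, a). 1 \<le> i \<and> i \<le> len ?\<alpha> \<and> a < level ?\<alpha> i}"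
    then obtain i a where g: "g = (Suc i, a)" "Suc i \<le> n" "a < level ?\<alpha> (Suc i)"
      using \<alpha>(2) by (cases g rule: tree_vertex_cases) auto
    show "snd (snd s) (Node g (map Leaf ((\<lambda>(i, a). map (Pair (i - 1)) (fibre ?\<alpha> (i - 1) i a)) g)))
        = snd (snd t) (Node g (map Leaf ((\<lambda>(i, a). map (Pair (i - 1)) (fibre ?\<alpha> (i - 1) i a)) g)))"
      using gen[OF g(2,3)] unfolding g(1) gen_eq_corolla .
  qed (use C \<alpha>(2) in \<open>auto simp: set_fibre colr_def\<close>)
qed

end

text \<open>The existence half of the universal property for tree operads. It is applied both to an
  arbitrary operad \<open>P\<close>, to build simplices, and to another tree operad, to analyse the
  two maps that make up a face.\<close>

lemma tree_hom_in:
  assumes "operad P" and \<alpha>: "\<alpha> \<in> chains n"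
    and f: "\<And>i a. i \<le> n \<Longrightarrow> a < level \<alpha> i \<Longrightarrow> f (i, a) \<in> colours P"
    and h: "\<And>i a. Suc i \<le> n \<Longrightarrow> a < level \<alpha> (Suc i) \<Longrightarrow> h (Suc i, a) \<in> operations P
      \<and> inputs P (h (Suc i, a)) = map (\<lambda>b. f (i, b)) (fibre \<alpha> i (Suc i) a)
      \<and> target P (h (Suc i, a)) = f (Suc i, a)"
  shows "induced_hom (tree_operad \<alpha>) P f h \<in> op_hom (tree_operad \<alpha>) P"
    and "i \<le> n \<Longrightarrow> a < level \<alpha> i \<Longrightarrow> fst (induced_hom (tree_operad \<alpha>) P f h) (i, a) = f (i, a)"
    and "Suc i \<le> n \<Longrightarrow> a < level \<alpha> (Suc i)
      \<Longrightarrow> snd (induced_hom (tree_operad \<alpha>) P f h) (gen \<alpha> (Suc i) a) = h (Suc i, a)"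
proof -
  have f': "f c \<in> colours P" if "c \<in> {(i, a). i \<le> len \<alpha> \<and> a < level \<alpha> i}" for c
    using that f chains_len[OF \<alpha>] by auto
  have h': "h g \<in> operations P \<and> inputs P (h g) = map f ((\<lambda>(i, a). map (Pair (i - 1)) (fibre \<alpha> (i - 1) i a)) g)
      \<and> target P (h g) = f ((\<lambda>(i, a). (i, a)) g)"
    if g: "g \<in> {(i, a). 1 \<le> i \<and> i \<le> len \<alpha> \<and> a < level \<alpha> i}" for g
  proof -
    obtain i a where "g = (Suc i, a)" "Suc i \<le> n" "a < level \<alpha> (Suc i)"
      using g chains_len[OF \<alpha>] by (cases g rule: tree_vertex_cases) simp_all
    then show ?thesis using h by (simp add: comp_def)
  qed
  show "induced_hom (tree_operad \<alpha>) P f h \<in> op_hom (tree_operad \<alpha>) P"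
    unfolding tree_operad_def by (rule induced_hom_in[OF assms(1) f' h']) auto
  show "i \<le> n \<Longrightarrow> a < level \<alpha> i \<Longrightarrow> fst (induced_hom (tree_operad \<alpha>) P f h) (i, a) = f (i, a)"
    using chains_len[OF \<alpha>] by (simp add: induced_hom_def)
  assume i: "Suc i \<le> n" "a < level \<alpha> (Suc i)"
  then have "eval_tree P f h (gen \<alpha> (Suc i) a) = h (Suc i, a)"
    unfolding gen_eq_corolla using chains_len[OF \<alpha>]
    by (intro eval_corolla[where G = "{(i, a). 1 \<le> i \<and> i \<le> len \<alpha> \<and> a < level \<alpha> i}", OF assms(1) f' h']) auto
  then show "snd (induced_hom (tree_operad \<alpha>) P f h) (gen \<alpha> (Suc i) a) = h (Suc i, a)"
    using gen_in(1)[OF \<alpha> i] by (simp add: induced_hom_def)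
qed

lemma simplex_of_labels:
  assumes "operad P" and \<alpha>: "\<alpha> \<in> chains n" "rooted \<alpha>"
    and f: "\<And>i a. i \<le> n \<Longrightarrow> a < level \<alpha> i \<Longrightarrow> f (i, a) \<in> colours P"
    and h: "\<And>i a. Suc i \<le> n \<Longrightarrow> a < level \<alpha> (Suc i) \<Longrightarrow> h (Suc i, a) \<in> operations P
      \<and> inputs P (h (Suc i, a)) = map (\<lambda>b. f (i, b)) (fibre \<alpha> i (Suc i) a)
      \<and> target P (h (Suc i, a)) = f (Suc i, a)"
  obtains s where "s \<in> nerve_simplices P n" "fst s = \<alpha>"
    "\<And>i a. i \<le> n \<Longrightarrow> a < level \<alpha> i \<Longrightarrow> colr s i a = f (i, a)"
    "\<And>i a. Suc i \<le> n \<Longrightarrow> a < level \<alpha> (Suc i) \<Longrightarrow> oper s i (Suc i) a = h (Suc i, a)"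
proof -
  let ?s = "(\<alpha>, induced_hom (tree_operad \<alpha>) P f h)"
  note x = tree_hom_in[where f = f and h = h, OF assms(1) \<alpha>(1) f h]
  have s: "?s \<in> nerve_simplices P n" using \<alpha> x(1) by (simp add: simplexI)
  show thesis
    using operad.oper_step[OF assms(1) s] x by (intro that[OF s]) (simp_all add: colr_def)
qed

text \<open>The function underlying \<open>list_nerve_ar\<close>, before its values are wrapped into
  one-element lists. It is stated without fixing the dimension.\<close>

definition post_comp :: "('c \<Rightarrow> 'd) \<times> ('o \<Rightarrow> 'p) \<Rightarrow> ('c, 'o) nerve_simplex \<Rightarrow> ('d, 'p) nerve_simplex" where
  "post_comp y s = (fst s, op_hom_comp (tree_operad (fst s)) y (snd s))"

lemma post_comp_simplex:
  assumes "operad P" "operad Q" and y: "y \<in> op_hom P Q" and s: "s \<in> nerve_simplices P n"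
  shows "post_comp y s \<in> nerve_simplices Q n"
    and "i \<le> n \<Longrightarrow> a < level (fst s) i \<Longrightarrow> colr (post_comp y s) i a = fst y (colr s i a)"
    and "i \<le> j \<Longrightarrow> j \<le> n \<Longrightarrow> a < level (fst s) j \<Longrightarrow> oper (post_comp y s) i j a = snd y (oper s i j a)"
  unfolding post_comp_def
  using op_hom_comp_in[OF operad_tree simplexD(3)[OF s] y] simplexD[OF s] gen_comp_in[OF simplexD(1)[OF s]]
  by (simp_all add: simplexI colr_def oper_def fst_op_hom_comp snd_op_hom_comp)

text \<open>The map of tree operads behind a face is the inclusion of a branch followed by the map
  induced by \<theta>. Since its source is free, its values on colours and generators are all that
  is needed.\<close>

lemma face_hom:
  assumes \<alpha>: "\<alpha> \<in> chains n" and \<theta>: "\<theta> \<in> order_maps {..k} {..n}" and a: "a < level \<alpha> (\<theta> k)"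
    and \<beta>: "\<beta> = pullback k \<theta> \<alpha>"
  defines "z \<equiv> op_hom_comp (tree_operad (branch \<beta> a)) (tree_pull k \<theta> \<alpha>) (tree_incl \<beta> a)"
  shows "z \<in> op_hom (tree_operad (branch \<beta> a)) (tree_operad \<alpha>)"
    and "i \<le> k \<Longrightarrow> c < length (fibre \<beta> i k a) \<Longrightarrow> fst z (i, c) = (\<theta> i, fibre \<beta> i k a ! c)"
    and "Suc i \<le> k \<Longrightarrow> c < length (fibre \<beta> (Suc i) k a)
      \<Longrightarrow> snd z (gen (branch \<beta> a) (Suc i) c) = gen_comp \<alpha> (\<theta> i) (\<theta> (Suc i)) (fibre \<beta> (Suc i) k a ! c)"
proof -
  note le = order_maps_le[OF \<theta>]
  have \<beta>': "\<beta> \<in> chains k" "len \<beta> = k" unfolding \<beta> using pullback_chains[OF \<alpha> \<theta>] by auto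
  have br: "branch \<beta> a \<in> chains k" by (rule branch_chains[OF \<beta>'(1)])
  have lev_br: "level (branch \<beta> a) i = length (fibre \<beta> i k a)" if "i \<le> k" for i
    using that by (simp add: level_branch \<beta>'(2))
  have lev: "level \<beta> i = level \<alpha> (\<theta> i)" if "i \<le> k" for i using that by (simp add: \<beta> level_pullback)
  let ?f = "\<lambda>(i, b). (i, fibre \<beta> i (len \<beta>) a ! b)" and ?h = "\<lambda>(i, b). gen \<beta> i (fibre \<beta> i (len \<beta>) a ! b)"
  have incl_f: "?f (i, c) \<in> colours (tree_operad \<beta>)"
    if "i \<le> k" "c < level (branch \<beta> a) i" for i c
    using that \<beta>'(2) by (simp add: lev_br fibre_nth)
  have incl_h: "?h (Suc i, c) \<in> operations (tree_operad \<beta>)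
      \<and> inputs (tree_operad \<beta>) (?h (Suc i, c))
        = map (\<lambda>b. ?f (i, b)) (fibre (branch \<beta> a) i (Suc i) c)
      \<and> target (tree_operad \<beta>) (?h (Suc i, c))
        = ?f (Suc i, c)"
    if "Suc i \<le> k" "c < level (branch \<beta> a) (Suc i)" for i c
  proof -
    have c: "c < length (fibre \<beta> (Suc i) k a)" using that by (simp add: lev_br)
    show ?thesis
      using gen_in[OF \<beta>'(1) that(1) fibre_nth(1)[OF c]]
      by (simp add: \<beta>'(2) comp_def fibre_branch[OF \<beta>'(1) _ that(1) c, of i, symmetric] del: tree_operad_sel)
  qed
  note * = tree_hom_in[where f = ?f and h = ?h, OF operad_tree br incl_f incl_h, folded tree_incl_def]
  have incl: "tree_incl \<beta> a \<in> op_hom (tree_operad (branch \<beta> a)) (tree_operad \<beta>)"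
    "i \<le> k \<Longrightarrow> c < length (fibre \<beta> i k a) \<Longrightarrow> fst (tree_incl \<beta> a) (i, c) = (i, fibre \<beta> i k a ! c)"
    "Suc i \<le> k \<Longrightarrow> c < length (fibre \<beta> (Suc i) k a)
      \<Longrightarrow> snd (tree_incl \<beta> a) (gen (branch \<beta> a) (Suc i) c) = gen \<beta> (Suc i) (fibre \<beta> (Suc i) k a ! c)" for i c
    using *(1) *(2)[of i c] *(3)[of i c] by (simp_all add: lev_br \<beta>'(2))
  \<comment> \<open>Under \<theta> a generator becomes the composite over all levels from
    \<open>\<theta> (i - 1)\<close> to \<open>\<theta> i\<close>, which is a unit when the two
    coincide.\<close>
  let ?f' = "\<lambda>(i, b). (\<theta> i, b)" and ?h' = "\<lambda>(i, b). gen_comp \<alpha> (\<theta> (i - 1)) (\<theta> i) b"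
  have pull_f: "?f' (i, c) \<in> colours (tree_operad \<alpha>)"
    if "i \<le> k" "c < level \<beta> i" for i c
    using that le by (simp add: lev chains_len[OF \<alpha>])
  have pull_h: "?h' (Suc i, c) \<in> operations (tree_operad \<alpha>)
      \<and> inputs (tree_operad \<alpha>) (?h' (Suc i, c))
        = map (\<lambda>b. ?f' (i, b)) (fibre \<beta> i (Suc i) c)
      \<and> target (tree_operad \<alpha>) (?h' (Suc i, c))
        = ?f' (Suc i, c)"
    if "Suc i \<le> k" "c < level \<beta> (Suc i)" for i c
    using gen_comp_in[OF \<alpha> le(2)[OF _ that(1)] le(1)[OF that(1)], of i c] that(1) that(2)[unfolded lev[OF that(1)]]
    by (simp add: \<beta> fibre_pullback[OF \<alpha> \<theta>] del: tree_operad_sel)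
  note * = tree_hom_in[where f = ?f' and h = ?h', OF operad_tree \<beta>'(1) pull_f pull_h,
      folded tree_pull_def[of k \<theta> \<alpha>, folded \<beta>]]
  have pull: "tree_pull k \<theta> \<alpha> \<in> op_hom (tree_operad \<beta>) (tree_operad \<alpha>)"
    "i \<le> k \<Longrightarrow> c < level \<beta> i \<Longrightarrow> fst (tree_pull k \<theta> \<alpha>) (i, c) = (\<theta> i, c)"
    "Suc i \<le> k \<Longrightarrow> c < level \<beta> (Suc i)
      \<Longrightarrow> snd (tree_pull k \<theta> \<alpha>) (gen \<beta> (Suc i) c) = gen_comp \<alpha> (\<theta> i) (\<theta> (Suc i)) c" for i c
    using *(1) *(2)[of i c] *(3)[of i c] by simp_all
  show "z \<in> op_hom (tree_operad (branch \<beta> a)) (tree_operad \<alpha>)"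
    unfolding z_def by (rule op_hom_comp_in[OF operad_tree incl(1) pull(1)])
  show "fst z (i, c) = (\<theta> i, fibre \<beta> i k a ! c)" if "i \<le> k" "c < length (fibre \<beta> i k a)"
    using that incl(2)[OF that] pull(2) by (simp add: z_def fst_op_hom_comp \<beta>'(2) lev_br fibre_nth)
  show "snd z (gen (branch \<beta> a) (Suc i) c) = gen_comp \<alpha> (\<theta> i) (\<theta> (Suc i)) (fibre \<beta> (Suc i) k a ! c)"
    if "Suc i \<le> k" "c < length (fibre \<beta> (Suc i) k a)"
    using incl(3)[OF that] pull(3)[OF that(1)] gen_in(1)[OF br that(1)] that
    by (simp add: z_def snd_op_hom_comp lev_br fibre_nth)
qed

section \<open>The list nerve is a functor\<close>

context operad
begin

text \<open>The dictionary that expresses a face through the shape and labels of \<open>s\<close>,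
  so that later arguments about faces need not return to trees. The enumeration of a fibre
  translates positions in the face into elements of \<open>s\<close>.\<close>

lemma face_simplex:
  assumes s: "s \<in> nerve_simplices P n" and \<theta>: "\<theta> \<in> order_maps {..k} {..n}" and a: "a < level (fst s) (\<theta> k)"
  shows "nerve_face k \<theta> a s \<in> nerve_simplices P k"
    and "fst (nerve_face k \<theta> a s) = branch (pullback k \<theta> (fst s)) a"
    and "i \<le> k \<Longrightarrow> level (fst (nerve_face k \<theta> a s)) i = length (fibre (fst s) (\<theta> i) (\<theta> k) a)"
    and "i \<le> k \<Longrightarrow> c < length (fibre (fst s) (\<theta> i) (\<theta> k) a)
      \<Longrightarrow> colr (nerve_face k \<theta> a s) i c = colr s (\<theta> i) (fibre (fst s) (\<theta> i) (\<theta> k) a ! c)"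
    and "i \<le> j \<Longrightarrow> j \<le> k \<Longrightarrow> c < length (fibre (fst s) (\<theta> j) (\<theta> k) a)
      \<Longrightarrow> map ((!) (fibre (fst s) (\<theta> i) (\<theta> k) a)) (fibre (fst (nerve_face k \<theta> a s)) i j c)
        = fibre (fst s) (\<theta> i) (\<theta> j) (fibre (fst s) (\<theta> j) (\<theta> k) a ! c)"
    and "i \<le> j \<Longrightarrow> j \<le> k \<Longrightarrow> c < length (fibre (fst s) (\<theta> j) (\<theta> k) a)
      \<Longrightarrow> oper (nerve_face k \<theta> a s) i j c = oper s (\<theta> i) (\<theta> j) (fibre (fst s) (\<theta> j) (\<theta> k) a ! c)"
proof -
  let ?\<alpha> = "fst s" and ?t = "nerve_face k \<theta> a s"
  define \<beta> where "\<beta> = pullback k \<theta> ?\<alpha>"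
  note \<alpha> = simplexD(1)[OF s] and le = order_maps_le[OF \<theta>] and z = face_hom[OF simplexD(1)[OF s] \<theta> a \<beta>_def]
  have \<beta>: "\<beta> \<in> chains k" "len \<beta> = k" unfolding \<beta>_def using pullback_chains[OF \<alpha> \<theta>] by auto
  have br: "branch \<beta> a \<in> chains k" by (rule branch_chains[OF \<beta>(1)])
  have fib: "fibre \<beta> i j c = fibre ?\<alpha> (\<theta> i) (\<theta> j) c" if "i \<le> j" "j \<le> k" for i j c
    unfolding \<beta>_def by (rule fibre_pullback[OF \<alpha> \<theta> that])
  define z where "z = op_hom_comp (tree_operad (branch \<beta> a)) (tree_pull k \<theta> ?\<alpha>) (tree_incl \<beta> a)"
  note z = z[folded z_def]
  have t: "?t = (branch \<beta> a, op_hom_comp (tree_operad (branch \<beta> a)) (snd s) z)"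
    by (simp add: nerve_face_def Let_def case_prod_unfold \<beta>_def z_def)
  show fst_t: "fst ?t = branch (pullback k \<theta> (fst s)) a" unfolding t by (simp add: \<beta>_def)
  have "rooted (branch \<beta> a)"
    using a by (intro branch_rooted) (simp add: \<beta>(2) \<beta>_def level_pullback)
  then show t_in: "?t \<in> nerve_simplices P k"
    unfolding t by (intro simplexI op_hom_comp_in[OF operad_tree z(1) simplexD(3)[OF s]] br)
  have lev: "level (fst ?t) i = length (fibre ?\<alpha> (\<theta> i) (\<theta> k) a)" if "i \<le> k" for i
    unfolding t using that by (simp add: level_branch \<beta>(2) fib)
  have col: "colr ?t i c = colr s (\<theta> i) (fibre ?\<alpha> (\<theta> i) (\<theta> k) a ! c)"
    if "i \<le> k" "c < length (fibre ?\<alpha> (\<theta> i) (\<theta> k) a)" for i c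
    using that lev[OF that(1)] z(2)[of i c] unfolding t
    by (simp add: colr_def fst_op_hom_comp \<beta>(2) fib)
  have fibres: "map ((!) (fibre ?\<alpha> (\<theta> i) (\<theta> k) a)) (fibre (fst ?t) i j c)
      = fibre ?\<alpha> (\<theta> i) (\<theta> j) (fibre ?\<alpha> (\<theta> j) (\<theta> k) a ! c)"
    if "i \<le> j" "j \<le> k" "c < length (fibre ?\<alpha> (\<theta> j) (\<theta> k) a)" for i j c
    using fibre_branch[OF \<beta>(1) that(1,2), of c a] that unfolding t by (simp add: fib)
  \<comment> \<open>For consecutive levels of the face the operation is the value on a generator,
    which \<open>face_hom\<close> supplies.\<close>
  have one_step: "oper ?t i (Suc i) c = oper s (\<theta> i) (\<theta> (Suc i)) (fibre ?\<alpha> (\<theta> (Suc i)) (\<theta> k) a ! c)"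
    if "Suc i \<le> k" "c < length (fibre ?\<alpha> (\<theta> (Suc i)) (\<theta> k) a)" for i c
  proof -
    have "oper ?t i (Suc i) c = snd (snd ?t) (gen (branch \<beta> a) (Suc i) c)"
      using oper_step[OF t_in that(1)] lev[OF that(1)] that(2) unfolding t by simp
    also have "\<dots> = snd (snd s) (snd z (gen (branch \<beta> a) (Suc i) c))"
      using gen_in(1)[OF br that(1), of c] lev[OF that(1)] that(2)
      unfolding t by (simp add: snd_op_hom_comp)
    finally show ?thesis using z(3)[OF that(1), of c] that by (simp add: fib oper_def)
  qed
  \<comment> \<open>For arbitrary levels, \<open>oper_comp\<close> splits the operation at level
    \<open>j\<close> in the face and at level \<open>\<theta> j\<close> in \<open>s\<close>;
    \<open>fibres\<close> matches the lists of inner operations.\<close>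
  have "oper ?t i j c = oper s (\<theta> i) (\<theta> j) (fibre ?\<alpha> (\<theta> j) (\<theta> k) a ! c)"
    if "i \<le> j" "j \<le> k" "c < length (fibre ?\<alpha> (\<theta> j) (\<theta> k) a)" for i j c
    using that
  proof (induction j arbitrary: c rule: dec_induct)
    case base
    then show ?case
      using oper_refl[OF t_in base(1), of c] oper_refl[OF s le(1)[OF base(1)]] fibre_nth(1)[OF base(2)]
      by (simp add: lev col)
  next
    case (step j)
    let ?d = "fibre ?\<alpha> (\<theta> (Suc j)) (\<theta> k) a ! c"
    have j: "j \<le> k" "Suc j \<le> k" "c < level (fst ?t) (Suc j)" using step.prems lev by auto
    have "oper ?t i j b = oper s (\<theta> i) (\<theta> j) (fibre ?\<alpha> (\<theta> j) (\<theta> k) a ! b)"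
      if "b \<in> set (fibre (fst ?t) j (Suc j) c)" for b
      using that j lev by (intro step.IH) (auto simp: set_fibre)
    then have "map (oper ?t i j) (fibre (fst ?t) j (Suc j) c)
        = map (oper s (\<theta> i) (\<theta> j)) (fibre ?\<alpha> (\<theta> j) (\<theta> (Suc j)) ?d)"
      using fibres[of j "Suc j" c, symmetric] step.prems by simp
    then show ?case
      using oper_comp[OF t_in step.hyps(1) _ j(2,3)] step.prems j
        oper_comp[OF s le(2)[OF step.hyps(1) j(1)] le(2)[OF _ j(2)] le(1)[OF j(2)] fibre_nth(1)[OF step.prems(2)]]
      by (simp add: one_step)
  qed
  with lev col fibres show
    "i \<le> k \<Longrightarrow> level (fst ?t) i = length (fibre ?\<alpha> (\<theta> i) (\<theta> k) a)"
    "i \<le> k \<Longrightarrow> c < length (fibre ?\<alpha> (\<theta> i) (\<theta> k) a)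
      \<Longrightarrow> colr ?t i c = colr s (\<theta> i) (fibre ?\<alpha> (\<theta> i) (\<theta> k) a ! c)"
    "i \<le> j \<Longrightarrow> j \<le> k \<Longrightarrow> c < length (fibre ?\<alpha> (\<theta> j) (\<theta> k) a)
      \<Longrightarrow> map ((!) (fibre ?\<alpha> (\<theta> i) (\<theta> k) a)) (fibre (fst ?t) i j c)
        = fibre ?\<alpha> (\<theta> i) (\<theta> j) (fibre ?\<alpha> (\<theta> j) (\<theta> k) a ! c)"
    "i \<le> j \<Longrightarrow> j \<le> k \<Longrightarrow> c < length (fibre ?\<alpha> (\<theta> j) (\<theta> k) a)
      \<Longrightarrow> oper ?t i j c = oper s (\<theta> i) (\<theta> j) (fibre ?\<alpha> (\<theta> j) (\<theta> k) a ! c)"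
    by blast+
qed

text \<open>Functoriality for a single entry of the list. The index \<open>a\<close> refers to a
  level of the face over \<open>b\<close>; the enumeration of the fibre over \<open>b\<close> turns
  it into an element of level \<open>\<theta> (\<psi> k)\<close> of \<open>s\<close>.\<close>

lemma face_face:
  assumes s: "s \<in> nerve_simplices P n"
    and \<theta>: "\<theta> \<in> order_maps {..m} {..n}" and \<psi>: "\<psi> \<in> order_maps {..k} {..m}"
    and b: "b < level (fst s) (\<theta> m)" and a: "a < length (fibre (fst s) (\<theta> (\<psi> k)) (\<theta> m) b)"
  shows "nerve_face k \<psi> a (nerve_face m \<theta> b s)
    = nerve_face k (compose {..k} \<theta> \<psi>) (fibre (fst s) (\<theta> (\<psi> k)) (\<theta> m) b ! a) s" (is "?l = ?r")
proof -
  let ?\<alpha> = "fst s" and ?\<chi> = "compose {..k} \<theta> \<psi>" and ?t = "nerve_face m \<theta> b s"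
  let ?a = "fibre ?\<alpha> (\<theta> (\<psi> k)) (\<theta> m) b ! a"
  note le = order_maps_le[OF \<psi>] and t = face_simplex[OF s \<theta> b]
  have \<chi>: "?\<chi> \<in> order_maps {..k} {..n}" by (rule order_maps_compose[OF \<theta> \<psi>])
  have \<chi>_eq: "?\<chi> i = \<theta> (\<psi> i)" if "i \<le> k" for i using that by (simp add: compose_eq)
  have a': "?a < level ?\<alpha> (?\<chi> k)" using fibre_nth(1)[OF a] by (simp add: \<chi>_eq)
  have at: "a < level (fst ?t) (\<psi> k)" using t(3)[OF le(1)[OF order_refl]] a by simp
  note l = face_simplex[OF t(1) \<psi> at] and r = face_simplex[OF s \<chi> a']
  have eq: "fst ?l = fst ?r"
    unfolding l(2) r(2) t(2)
    using branch_pullback_branch[OF simplexD(1)[OF s] \<theta> \<psi> refl, of a b] a le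
    by (simp add: fibre_pullback[OF simplexD(1)[OF s] \<theta>])
  have emb: "map ((!) (fibre ?\<alpha> (\<theta> (\<psi> i)) (\<theta> m) b)) (fibre (fst ?t) (\<psi> i) (\<psi> k) a)
      = fibre ?\<alpha> (?\<chi> i) (?\<chi> k) ?a" if "i \<le> k" for i
    using t(5)[OF le(2)[OF that order_refl] le(1)[OF order_refl] a] that by (simp add: \<chi>_eq)
  \<comment> \<open>A position in a level of the iterated face reaches the same element of
    \<open>s\<close> in two stages through \<open>?t\<close> as in one stage along
    \<open>?\<chi>\<close>.\<close>
  have nth: "fibre (fst ?t) (\<psi> i) (\<psi> k) a ! c < length (fibre ?\<alpha> (\<theta> (\<psi> i)) (\<theta> m) b)"
    "fibre ?\<alpha> (?\<chi> i) (?\<chi> k) ?a ! c = fibre ?\<alpha> (\<theta> (\<psi> i)) (\<theta> m) b ! (fibre (fst ?t) (\<psi> i) (\<psi> k) a ! c)"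
    "c < length (fibre (fst ?t) (\<psi> i) (\<psi> k) a)" "c < length (fibre ?\<alpha> (?\<chi> i) (?\<chi> k) ?a)"
    if "i \<le> k" "c < level (fst ?l) i" for i c
  proof -
    show c: "c < length (fibre (fst ?t) (\<psi> i) (\<psi> k) a)" using that l(3) by simp
    show "fibre (fst ?t) (\<psi> i) (\<psi> k) a ! c < length (fibre ?\<alpha> (\<theta> (\<psi> i)) (\<theta> m) b)"
      using fibre_nth(1)[OF c] t(3)[OF le(1)[OF that(1)]] by simp
    show "fibre ?\<alpha> (?\<chi> i) (?\<chi> k) ?a ! c = fibre ?\<alpha> (\<theta> (\<psi> i)) (\<theta> m) b ! (fibre (fst ?t) (\<psi> i) (\<psi> k) a ! c)"
      "c < length (fibre ?\<alpha> (?\<chi> i) (?\<chi> k) ?a)"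
      using c by (simp_all flip: emb[OF that(1)])
  qed
  show ?thesis
  proof (rule simplex_eqI[OF l(1) r(1) eq])
    show "colr ?l i c = colr ?r i c" if "i \<le> k" "c < level (fst ?l) i" for i c
      using l(4)[OF that(1) nth(3)[OF that]] r(4)[OF that(1) nth(4)[OF that]]
        t(4)[OF le(1)[OF that(1)] nth(1)[OF that]] nth(2)[OF that] that by (simp add: \<chi>_eq)
    show "oper ?l i (Suc i) c = oper ?r i (Suc i) c" if "Suc i \<le> k" "c < level (fst ?l) (Suc i)" for i c
      using l(6)[OF _ that(1) nth(3)[OF that]] r(6)[OF _ that(1) nth(4)[OF that]]
        t(6)[OF le(2)[OF _ that(1)] le(1)[OF that(1)] nth(1)[OF that], of i] nth(2)[OF that] that
      by (simp add: \<chi>_eq)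
  qed
qed

text \<open>In a rooted chain everything lies over the single top element, so restricting to its
  branch and renumbering changes nothing.\<close>

lemma face_id:
  assumes s: "s \<in> nerve_simplices P n"
  shows "nerve_face n (\<lambda>i\<in>{..n}. i) 0 s = s"
proof -
  define \<iota> where "\<iota> = (\<lambda>i\<in>{..n}. i)"
  have \<iota>: "\<iota> i = i" if "i \<le> n" for i using that by (simp add: \<iota>_def)
  have i: "\<iota> \<in> order_maps {..n} {..n}" by (auto simp: \<iota>_def order_maps_def intro!: mono_onI)
  have z: "0 < level (fst s) (\<iota> n)" using simplexD(5)[OF s] by (simp add: \<iota>)
  note t = face_simplex[OF s i z]
  have fib: "fibre (fst s) i n 0 = [0..<level (fst s) i]" if "i \<le> n" for i
    using fibre_rooted[OF simplexD(1,2)[OF s] that] .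
  have lev: "level (fst (nerve_face n \<iota> 0 s)) j = level (fst s) j" if "j \<le> n" for j
    using t(3)[OF that] fib that by (simp add: \<iota>)
  have "map ((!) [0..<level (fst s) j]) (fibre (fst (nerve_face n \<iota> 0 s)) j (Suc j) c) = fibre (fst s) j (Suc j) c"
    if "Suc j \<le> n" "c < level (fst s) (Suc j)" for j c
    using t(5)[of j "Suc j" c] that fib by (simp add: \<iota>)
  then have "length (fibre (fst (nerve_face n \<iota> 0 s)) j (Suc j) c) = length (fibre (fst s) j (Suc j) c)"
    if "Suc j \<le> n" "c < level (fst s) (Suc j)" for j c
    using that by (metis length_map)
  then have eq: "fst (nerve_face n \<iota> 0 s) = fst s"
    using lev by (intro chain_eqI[OF simplexD(1)[OF t(1)] simplexD(1)[OF s]]) auto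
  show ?thesis
    unfolding \<iota>_def[symmetric]
  proof (rule simplex_eqI[OF t(1) s eq])
    show "colr (nerve_face n \<iota> 0 s) j c = colr s j c" if "j \<le> n" "c < level (fst (nerve_face n \<iota> 0 s)) j" for j c
      using t(4)[of j c] that fib lev by (simp add: \<iota>)
    show "oper (nerve_face n \<iota> 0 s) j (Suc j) c = oper s j (Suc j) c"
      if "Suc j \<le> n" "c < level (fst (nerve_face n \<iota> 0 s)) (Suc j)" for j c
      using t(6)[of j "Suc j" c] that fib lev by (simp add: \<iota>)
  qed
qed

end

text \<open>A face reindexes the labels and \<open>y\<close> changes their values, so the two
  operations commute; the shape depends on the face alone.\<close>

lemma face_op_hom_comp:
  assumes P: "operad P" and Q: "operad Q" and y: "y \<in> op_hom P Q" and s: "s \<in> nerve_simplices P n"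
    and \<theta>: "\<theta> \<in> order_maps {..k} {..n}" and a: "a < level (fst s) (\<theta> k)"
  shows "nerve_face k \<theta> a (post_comp y s) = post_comp y (nerve_face k \<theta> a s)"
proof -
  let ?Y = "post_comp y"
  have fst_Y: "fst (?Y t) = fst t" for t by (simp add: post_comp_def)
  have a': "a < level (fst (?Y s)) (\<theta> k)" using a by (simp add: fst_Y)
  note f = operad.face_simplex[OF P s \<theta> a]
  note Ys = post_comp_simplex[OF P Q y s] and Yf = post_comp_simplex[OF P Q y f(1)]
  note fY = operad.face_simplex[OF Q Ys(1) \<theta> a']
  note le = order_maps_le[OF \<theta>]
  show ?thesis
  proof (rule operad.simplex_eqI[OF Q fY(1) Yf(1)])
    show eq: "fst (nerve_face k \<theta> a (?Y s)) = fst (?Y (nerve_face k \<theta> a s))"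
      by (simp add: fst_Y f(2) fY(2))
    fix i c
    show "colr (nerve_face k \<theta> a (?Y s)) i c = colr (?Y (nerve_face k \<theta> a s)) i c"
      if i: "i \<le> k" and "c < level (fst (nerve_face k \<theta> a (?Y s))) i"
    proof -
      have c: "c < length (fibre (fst s) (\<theta> i) (\<theta> k) a)" "c < level (fst (nerve_face k \<theta> a s)) i"
        using that f(3)[OF i] by (simp_all add: eq fst_Y)
      show ?thesis
        using fY(4)[OF i] Yf(2)[OF i c(2)] f(4)[OF i c(1)] Ys(2)[OF le(1)[OF i] fibre_nth(1)[OF c(1)]] c(1)
        by (simp add: fst_Y)
    qed
    show "oper (nerve_face k \<theta> a (?Y s)) i (Suc i) c = oper (?Y (nerve_face k \<theta> a s)) i (Suc i) c"
      if i: "Suc i \<le> k" and "c < level (fst (nerve_face k \<theta> a (?Y s))) (Suc i)"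
    proof -
      have c: "c < length (fibre (fst s) (\<theta> (Suc i)) (\<theta> k) a)" "c < level (fst (nerve_face k \<theta> a s)) (Suc i)"
        using that f(3)[OF i] by (simp_all add: eq fst_Y)
      show ?thesis
        using fY(6)[OF _ i, of i c] Yf(3)[OF _ i c(2), of i] f(6)[OF _ i c(1), of i]
          Ys(3)[OF le(2)[OF _ i] le(1)[OF i] fibre_nth(1)[OF c(1)], of i] c(1)
        by (simp add: fst_Y)
    qed
  qed
qed

section \<open>The categories\<close>

lemma category_simplex: "category simplex_cat"
proof
  fix a :: nat
  have "(\<lambda>i\<in>{..a}. i) \<in> order_maps {..a} {..a}" by (auto simp: order_maps_def intro!: mono_onI)
  then show "Id simplex_cat a \<in> Hom simplex_cat a a" by (simp add: simplex_cat_def)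
next
  fix a b c :: nat and f g
  assume "f \<in> Hom simplex_cat a b" "g \<in> Hom simplex_cat b c"
  then show "Comp simplex_cat a b c g f \<in> Hom simplex_cat a c"
    by (simp add: simplex_cat_def order_maps_compose)
next
  fix a b :: nat and f
  assume "f \<in> Hom simplex_cat a b"
  then have f: "f \<in> {..a} \<rightarrow> {..b}" "f \<in> extensional {..a}"
    by (auto simp: simplex_cat_def order_maps_def PiE_def)
  show "Comp simplex_cat a b b (Id simplex_cat b) f = f" "Comp simplex_cat a a b f (Id simplex_cat a) = f"
    using Id_compose[OF f] compose_Id[OF f] by (simp_all add: simplex_cat_def)
next
  fix a b c d :: nat and f g h
  assume "f \<in> Hom simplex_cat a b" "g \<in> Hom simplex_cat b c" "h \<in> Hom simplex_cat c d"
  then have "f \<in> {..a} \<rightarrow> {..b}" by (auto simp: simplex_cat_def order_maps_def)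
  from compose_assoc[OF this, of h g]
  show "Comp simplex_cat a b d (Comp simplex_cat b c d h g) f = Comp simplex_cat a c d h (Comp simplex_cat a b c g f)"
    by (simp add: simplex_cat_def)
qed

lemma category_opposite:
  assumes "category C"
  shows "category (opposite C)"
proof -
  interpret category C by fact
  show ?thesis
    by unfold_locales (simp_all add: opposite_def Id_in_Hom Comp_in_Hom Comp_Id_left Comp_Id_right Comp_assoc)
qed

lemma concat_map_singleton: "concat (map (\<lambda>x. [f x]) xs) = map f xs"
  by (induction xs) auto

lemma concat_map_unit: "xs \<in> lists A \<Longrightarrow> concat (map (\<lambda>a\<in>A. [a]) xs) = xs"
  by (induction rule: lists.induct) auto

lemma category_List: "category (List_cat :: ('x set, 'x \<Rightarrow> 'x list) category)"
proof
  fix A :: "'x set"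
  show "Id List_cat A \<in> Hom List_cat A A" by (auto simp: List_cat_def)
next
  fix A B C :: "'x set" and u v
  assume "u \<in> Hom List_cat A B" "v \<in> Hom List_cat B C"
  then have u: "\<And>a. a \<in> A \<Longrightarrow> set (u a) \<subseteq> B" and v: "\<And>b. b \<in> B \<Longrightarrow> set (v b) \<subseteq> C"
    by (auto simp: List_cat_def)
  have "set (concat (map v (u a))) \<subseteq> C" if "a \<in> A" for a
    using u[OF that] v by auto
  then show "Comp List_cat A B C v u \<in> Hom List_cat A C"
    by (simp add: List_cat_def lists_eq_set restrict_PiE_iff)
next
  fix A B :: "'x set" and u
  assume "u \<in> Hom List_cat A B"
  then have u: "u \<in> A \<rightarrow>\<^sub>E lists B" by (simp add: List_cat_def)
  then have "concat (map (\<lambda>a\<in>B. [a]) (u a)) = u a" if "a \<in> A" for a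
    using that by (auto intro: concat_map_unit)
  then show "Comp List_cat A B B (Id List_cat B) u = u"
    using u by (intro ext) (auto simp: List_cat_def PiE_def extensional_def)
  show "Comp List_cat A A B u (Id List_cat A) = u"
    using u by (intro ext) (auto simp: List_cat_def PiE_def extensional_def)
next
  fix A B C D :: "'x set" and u v w :: "'x \<Rightarrow> 'x list"
  assume "u \<in> Hom List_cat A B"
  then have u: "u a \<in> lists B" if "a \<in> A" for a using that by (auto simp: List_cat_def)
  have "concat (map (\<lambda>b\<in>B. concat (map w (v b))) xs) = concat (map w (concat (map v xs)))"
    if "xs \<in> lists B" for xs
    using that by (induction xs) auto
  with u show "Comp List_cat A B D (Comp List_cat B C D w v) u = Comp List_cat A C D w (Comp List_cat A B C v u)"
    by (auto simp: List_cat_def)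
qed

lemma category_Op: "category Op_cat"
proof
  fix P :: "('a, 'b) operad"
  assume "P \<in> Obj Op_cat"
  then interpret operad P by (simp add: Op_cat_def)
  have comp: "p \<in> operations P \<and> set qs \<subseteq> operations P \<and> op_comp P p qs \<in> operations P"
    if "composable P p qs" for p qs
    using that comp_in by (auto simp: composable_def)
  have map: "map (\<lambda>x\<in>A. x) xs = xs" if "set xs \<subseteq> A" for A and xs :: "'z list"
    using that by (intro map_idI) auto
  have "op_hom_id P \<in> op_hom P P"
    unfolding op_hom_id_def using comp
    by (intro op_homI) (auto simp: map inputs_in target_in unit_in)
  then show "Id Op_cat P \<in> Hom Op_cat P P" by (simp add: Op_cat_def)
next
  fix P Q R :: "('a, 'b) operad" and x y
  assume "P \<in> Obj Op_cat" "x \<in> Hom Op_cat P Q" "y \<in> Hom Op_cat Q R"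
  then show "Comp Op_cat P Q R y x \<in> Hom Op_cat P R"
    by (simp add: Op_cat_def op_hom_comp_in)
next
  fix P Q :: "('a, 'b) operad" and x
  assume "x \<in> Hom Op_cat P Q"
  then have "x \<in> op_hom P Q" by (simp add: Op_cat_def)
  from op_homD(1,2)[OF this] show "Comp Op_cat P Q Q (Id Op_cat Q) x = x" "Comp Op_cat P P Q x (Id Op_cat P) = x"
    by (auto simp: Op_cat_def op_hom_comp_def op_hom_id_def PiE_def Id_compose compose_Id)
next
  fix P Q R S :: "('a, 'b) operad" and x y z
  assume "x \<in> Hom Op_cat P Q"
  then have "x \<in> op_hom P Q" by (simp add: Op_cat_def)
  from op_homD(1,2)[OF this]
  have x: "fst x \<in> colours P \<rightarrow> colours Q" "snd x \<in> operations P \<rightarrow> operations Q" by (auto simp: PiE_def)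
  show "Comp Op_cat P Q S (Comp Op_cat Q R S z y) x = Comp Op_cat P R S z (Comp Op_cat P Q R y x)"
    by (simp add: Op_cat_def op_hom_comp_def
        compose_assoc[OF x(1), of "fst z" "fst y"] compose_assoc[OF x(2), of "snd z" "snd y"])
qed

section \<open>Simplicial lists and their morphisms\<close>

text \<open>A component has only one-element lists as values, and \<open>hd\<close> recovers the
  function it stands for. Naturality then takes the form in which the right-hand side is a plain
  application.\<close>

lemma slist_homD:
  assumes "\<eta> \<in> slist_hom X Y"
  shows "\<eta> n \<in> F_ob X n \<rightarrow>\<^sub>E lists (F_ob Y n)"
    and "x \<in> F_ob X n \<Longrightarrow> \<eta> n x = [hd (\<eta> n x)]"
    and "x \<in> F_ob X n \<Longrightarrow> hd (\<eta> n x) \<in> F_ob Y n"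
    and "\<theta> \<in> order_maps {..k} {..n} \<Longrightarrow> x \<in> F_ob X n
      \<Longrightarrow> concat (map (\<eta> k) (F_ar X n k \<theta> x)) = F_ar Y n k \<theta> (hd (\<eta> n x))"
proof -
  have n: "\<eta> n \<in> F_ob X n \<rightarrow>\<^sub>E lists (F_ob Y n)" for n
    using assms by (auto simp: slist_hom_def nat_transfs_def List_cat_def opposite_def simplex_cat_def)
  then show "\<eta> n \<in> F_ob X n \<rightarrow>\<^sub>E lists (F_ob Y n)" .
  have single: "\<eta> n x = [hd (\<eta> n x)]" if "x \<in> F_ob X n" for x n
  proof -
    have "length (\<eta> n x) = Suc 0" using assms that by (simp add: slist_hom_def)
    then show ?thesis by (auto simp: length_Suc_conv)
  qed
  then show "x \<in> F_ob X n \<Longrightarrow> \<eta> n x = [hd (\<eta> n x)]" .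
  show "x \<in> F_ob X n \<Longrightarrow> hd (\<eta> n x) \<in> F_ob Y n"
    using n single by (metis PiE_mem in_listsD list.set_intros(1))
  show "concat (map (\<eta> k) (F_ar X n k \<theta> x)) = F_ar Y n k \<theta> (hd (\<eta> n x))"
    if "\<theta> \<in> order_maps {..k} {..n}" "x \<in> F_ob X n"
  proof -
    have "Comp List_cat (F_ob X n) (F_ob X k) (F_ob Y k) (\<eta> k) (F_ar X n k \<theta>)
        = Comp List_cat (F_ob X n) (F_ob Y n) (F_ob Y k) (F_ar Y n k \<theta>) (\<eta> n)"
      using assms that(1) by (simp add: slist_hom_def nat_transfs_def opposite_def simplex_cat_def)
    from fun_cong[OF this, of x] that(2)
    have "concat (map (\<eta> k) (F_ar X n k \<theta> x)) = concat (map (F_ar Y n k \<theta>) (\<eta> n x))"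
      by (simp add: List_cat_def)
    then show ?thesis using single[OF that(2)] by (metis append_Nil2 concat.simps list.simps(8,9))
  qed
qed

lemma slist_homI:
  assumes "\<And>n. \<eta> n \<in> extensional (F_ob X n)"
    and "\<And>n x. x \<in> F_ob X n \<Longrightarrow> \<eta> n x = [g n x]"
    and "\<And>n x. x \<in> F_ob X n \<Longrightarrow> g n x \<in> F_ob Y n"
    and "\<And>n k \<theta> x. \<theta> \<in> order_maps {..k} {..n} \<Longrightarrow> x \<in> F_ob X n
      \<Longrightarrow> concat (map (\<eta> k) (F_ar X n k \<theta> x)) = F_ar Y n k \<theta> (g n x)"
  shows "\<eta> \<in> slist_hom X Y"
proof -
  have "\<eta> n \<in> F_ob X n \<rightarrow>\<^sub>E lists (F_ob Y n)" for n
    using assms(1-3) by (auto simp: PiE_def)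
  moreover have "Comp List_cat (F_ob X n) (F_ob X k) (F_ob Y k) (\<eta> k) (F_ar X n k \<theta>)
      = Comp List_cat (F_ob X n) (F_ob Y n) (F_ob Y k) (F_ar Y n k \<theta>) (\<eta> n)"
    if "\<theta> \<in> order_maps {..k} {..n}" for n k \<theta>
    using assms(2) assms(4)[OF that] by (auto simp: List_cat_def)
  ultimately show ?thesis
    using assms(2) by (auto simp: slist_hom_def nat_transfs_def opposite_def simplex_cat_def List_cat_def)
qed

text \<open>The unit and associativity laws are inherited from \<open>List_cat\<close> in each
  dimension. What needs an argument is that identities and composites are natural with values of
  length one.\<close>

lemma category_sList: "category (sList_cat :: ('x slist, nat \<Rightarrow> 'x \<Rightarrow> 'x list) category)"
proof
  fix X :: "'x slist"
  assume "X \<in> Obj sList_cat"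
  then interpret cat_functor "opposite simplex_cat" List_cat X by (simp add: sList_cat_def)
  have "F_ar X n k \<theta> x \<in> lists (F_ob X k)" if "\<theta> \<in> order_maps {..k} {..n}" "x \<in> F_ob X n" for n k \<theta> x
    using F_ar_in[of n k \<theta>] that by (auto simp: opposite_def simplex_cat_def List_cat_def)
  then have "concat (map (\<lambda>a\<in>F_ob X k. [a]) (F_ar X n k \<theta> x)) = F_ar X n k \<theta> x"
    if "\<theta> \<in> order_maps {..k} {..n}" "x \<in> F_ob X n" for n k \<theta> x
    using that by (intro concat_map_unit)
  then have "(\<lambda>n. Id List_cat (F_ob X n)) \<in> slist_hom X X"
    by (intro slist_homI[where g = "\<lambda>n x. x"]) (auto simp: List_cat_def)
  then show "Id sList_cat X \<in> Hom sList_cat X X" by (simp add: sList_cat_def)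
next
  fix X Y Z :: "'x slist" and \<sigma> \<tau>
  assume X: "X \<in> Obj sList_cat" and "\<sigma> \<in> Hom sList_cat X Y" "\<tau> \<in> Hom sList_cat Y Z"
  then have \<sigma>: "\<sigma> \<in> slist_hom X Y" and \<tau>: "\<tau> \<in> slist_hom Y Z" by (simp_all add: sList_cat_def)
  interpret cat_functor "opposite simplex_cat" List_cat X using X by (simp add: sList_cat_def)
  let ?g = "\<lambda>n x. hd (\<tau> n (hd (\<sigma> n x)))"
  \<comment> \<open>On one-element lists the concatenating composition of listings is composition of
    functions.\<close>
  have eq: "Comp sList_cat X Y Z \<tau> \<sigma> n x = \<tau> n (hd (\<sigma> n x))" if "x \<in> F_ob X n" for n x
    using that slist_homD(2)[OF \<sigma> that] by (simp add: sList_cat_def List_cat_def) (metis append_Nil2 concat.simps list.simps(8,9))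
  have "Comp sList_cat X Y Z \<tau> \<sigma> \<in> slist_hom X Z"
  proof (rule slist_homI[where g = ?g])
    show "Comp sList_cat X Y Z \<tau> \<sigma> n \<in> extensional (F_ob X n)" for n
      by (simp add: sList_cat_def List_cat_def)
    show "Comp sList_cat X Y Z \<tau> \<sigma> n x = [?g n x]" if "x \<in> F_ob X n" for n x
      using eq[OF that] slist_homD(2)[OF \<tau> slist_homD(3)[OF \<sigma> that]] by simp
    show "?g n x \<in> F_ob Z n" if "x \<in> F_ob X n" for n x
      using slist_homD(3)[OF \<tau> slist_homD(3)[OF \<sigma> that]] .
    fix n k \<theta> x
    assume \<theta>: "\<theta> \<in> order_maps {..k} {..n}" and x: "x \<in> F_ob X n"
    have "F_ar X n k \<theta> x \<in> lists (F_ob X k)"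
      using F_ar_in[of n k \<theta>] \<theta> x by (auto simp: opposite_def simplex_cat_def List_cat_def)
    then have "concat (map (Comp sList_cat X Y Z \<tau> \<sigma> k) (F_ar X n k \<theta> x))
        = concat (map (\<tau> k) (concat (map (\<sigma> k) (F_ar X n k \<theta> x))))"
    proof (induction rule: lists.induct)
      case (Cons y ys)
      then show ?case using eq[of y k] slist_homD(2)[OF \<sigma>, of y k]
        by simp (metis append.right_neutral append_Cons append_Nil concat.simps list.simps(8,9))
    qed simp
    then show "concat (map (Comp sList_cat X Y Z \<tau> \<sigma> k) (F_ar X n k \<theta> x)) = F_ar Z n k \<theta> (?g n x)"
      using slist_homD(4)[OF \<sigma> \<theta> x] slist_homD(4)[OF \<tau> \<theta> slist_homD(3)[OF \<sigma> x]] by simp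
  qed
  then show "Comp sList_cat X Y Z \<tau> \<sigma> \<in> Hom sList_cat X Z" by (simp add: sList_cat_def)
next
  interpret L: category "List_cat :: ('x set, 'x \<Rightarrow> 'x list) category" by (rule category_List)
  have in_Hom: "\<sigma> n \<in> Hom List_cat (F_ob X n) (F_ob Y n)" if "\<sigma> \<in> Hom sList_cat X Y" for X Y :: "'x slist" and \<sigma> n
    using slist_homD(1)[of \<sigma> X Y n] that by (simp add: sList_cat_def List_cat_def)
  have Obj: "A \<in> Obj List_cat" for A :: "'x set" by (simp add: List_cat_def)
  {
    fix X Y :: "'x slist" and \<sigma>
    assume "\<sigma> \<in> Hom sList_cat X Y"
    from in_Hom[OF this] show "Comp sList_cat X Y Y (Id sList_cat Y) \<sigma> = \<sigma>"
      "Comp sList_cat X X Y \<sigma> (Id sList_cat X) = \<sigma>"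
      by (auto simp: sList_cat_def L.Comp_Id_left L.Comp_Id_right Obj)
  next
    fix W X Y Z :: "'x slist" and \<rho> \<sigma> \<tau>
    assume "\<rho> \<in> Hom sList_cat W X" "\<sigma> \<in> Hom sList_cat X Y" "\<tau> \<in> Hom sList_cat Y Z"
    from in_Hom[OF this(1)] in_Hom[OF this(2)] in_Hom[OF this(3)]
    show "Comp sList_cat W X Z (Comp sList_cat X Y Z \<tau> \<sigma>) \<rho> = Comp sList_cat W Y Z \<tau> (Comp sList_cat W X Y \<sigma> \<rho>)"
      using L.Comp_assoc[OF Obj Obj Obj Obj] by (simp add: sList_cat_def)
  }
qed

section \<open>Functoriality of the list nerve\<close>

lemma F_ob_nerve [simp]: "F_ob (list_nerve_ob P) = nerve_simplices P"
  by (simp add: list_nerve_ob_def)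

lemma F_ar_nerve: "s \<in> nerve_simplices P n
    \<Longrightarrow> F_ar (list_nerve_ob P) n k \<theta> s = map (\<lambda>a. nerve_face k \<theta> a s) [0..<level (fst s) (\<theta> k)]"
  by (simp add: list_nerve_ob_def split: prod.splits)

lemma F_ar_nerve_extensional: "F_ar (list_nerve_ob P) n k \<theta> \<in> extensional (nerve_simplices P n)"
  by (simp add: list_nerve_ob_def)

text \<open>For composition, \<open>face_face\<close> indexes the faces of the face over
  \<open>b\<close> by the fibre over \<open>b\<close>; concatenating over all \<open>b\<close>
  yields level \<open>\<theta> (\<psi> k)\<close> in its own order by
  \<open>concat_fibres_all\<close>. For identities, rootedness leaves exactly one entry.\<close>

lemma list_nerve_functor:
  assumes "operad P"
  shows "cat_functor (opposite simplex_cat) List_cat (list_nerve_ob P)"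
proof -
  interpret operad P by fact
  interpret S: category "opposite simplex_cat" by (rule category_opposite[OF category_simplex])
  interpret L: category "List_cat :: (('a, 'b) nerve_simplex set, ('a, 'b) nerve_simplex \<Rightarrow> ('a, 'b) nerve_simplex list) category"
    by (rule category_List)
  let ?N = "list_nerve_ob P"
  show ?thesis
  proof
    show "F_ob ?N n \<in> Obj List_cat" for n by (simp add: List_cat_def)
  next
    fix n k :: nat and \<theta>
    assume "\<theta> \<in> Hom (opposite simplex_cat) n k"
    then have \<theta>: "\<theta> \<in> order_maps {..k} {..n}" by (simp add: opposite_def simplex_cat_def)
    show "F_ar ?N n k \<theta> \<in> Hom List_cat (F_ob ?N n) (F_ob ?N k)"
      using face_simplex(1)[OF _ \<theta>] F_ar_nerve_extensional[of P n k \<theta>]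
      by (auto simp: List_cat_def PiE_def F_ar_nerve)
  next
    fix n :: nat
    have "F_ar ?N n n (\<lambda>i\<in>{..n}. i) s = [s]" if "s \<in> nerve_simplices P n" for s
      using simplexD(5)[OF that] face_id[OF that] by (simp add: F_ar_nerve[OF that])
    then show "F_ar ?N n n (Id (opposite simplex_cat) n) = Id List_cat (F_ob ?N n)"
      using F_ar_nerve_extensional[of P n n]
      by (intro extensionalityI[where A = "nerve_simplices P n"]) (simp_all add: opposite_def simplex_cat_def List_cat_def)
  next
    fix n m k :: nat and \<theta> \<psi>
    assume "\<theta> \<in> Hom (opposite simplex_cat) n m" "\<psi> \<in> Hom (opposite simplex_cat) m k"
    then have \<theta>: "\<theta> \<in> order_maps {..m} {..n}" and \<psi>: "\<psi> \<in> order_maps {..k} {..m}"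
      by (simp_all add: opposite_def simplex_cat_def)
    let ?\<chi> = "compose {..k} \<theta> \<psi>"
    have "F_ar ?N n k ?\<chi> s = concat (map (F_ar ?N m k \<psi>) (F_ar ?N n m \<theta> s))"
      if s: "s \<in> nerve_simplices P n" for s
    proof -
      let ?\<phi> = "fibre (fst s) (\<theta> (\<psi> k)) (\<theta> m)"
      have le: "\<theta> (\<psi> k) \<le> \<theta> m" "\<theta> m \<le> n"
        using order_maps_le[OF \<theta>] order_maps_le(1)[OF \<psi>] by auto
      have "F_ar ?N m k \<psi> (nerve_face m \<theta> b s) = map (\<lambda>a. nerve_face k ?\<chi> a s) (?\<phi> b)"
        if b: "b < level (fst s) (\<theta> m)" for b
      proof -
        note f = face_simplex[OF s \<theta> b]
        have "F_ar ?N m k \<psi> (nerve_face m \<theta> b s)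
            = map (\<lambda>a. nerve_face k \<psi> a (nerve_face m \<theta> b s)) [0..<length (?\<phi> b)]"
          using f(3)[OF order_maps_le(1)[OF \<psi>]] by (simp add: F_ar_nerve[OF f(1)])
        also have "\<dots> = map (\<lambda>a. nerve_face k ?\<chi> (?\<phi> b ! a) s) [0..<length (?\<phi> b)]"
          using face_face[OF s \<theta> \<psi> b] by simp
        also have "\<dots> = map (\<lambda>a. nerve_face k ?\<chi> a s) (map ((!) (?\<phi> b)) [0..<length (?\<phi> b)])"
          by simp
        finally show ?thesis by (simp only: map_nth)
      qed
      then have "map (F_ar ?N m k \<psi>) (F_ar ?N n m \<theta> s)
          = map (map (\<lambda>a. nerve_face k ?\<chi> a s)) (map ?\<phi> [0..<level (fst s) (\<theta> m)])"
        by (simp add: F_ar_nerve[OF s])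
      then have "concat (map (F_ar ?N m k \<psi>) (F_ar ?N n m \<theta> s))
          = map (\<lambda>a. nerve_face k ?\<chi> a s) [0..<level (fst s) (\<theta> (\<psi> k))]"
        unfolding concat_fibres_all[OF simplexD(1)[OF s] le, symmetric] by (simp add: map_concat)
      then show ?thesis by (simp add: F_ar_nerve[OF s] compose_eq)
    qed
    then show "F_ar ?N n k (Comp (opposite simplex_cat) n m k \<psi> \<theta>)
        = Comp List_cat (F_ob ?N n) (F_ob ?N m) (F_ob ?N k) (F_ar ?N m k \<psi>) (F_ar ?N n m \<theta>)"
      using F_ar_nerve_extensional[of P n k ?\<chi>]
      by (intro extensionalityI[where A = "nerve_simplices P n"]) (simp_all add: opposite_def simplex_cat_def List_cat_def)
  qed
qed

lemma list_nerve_ar_eq: "list_nerve_ar P Q y n = (\<lambda>s\<in>nerve_simplices P n. [post_comp y s])"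
  by (simp add: list_nerve_ar_def post_comp_def case_prod_unfold)

text \<open>Naturality holds entry by entry through \<open>face_op_hom_comp\<close>; the lists have
  equal length because post-composition keeps the shape.\<close>

lemma list_nerve_ar_in:
  assumes P: "operad P" and Q: "operad Q" and y: "y \<in> op_hom P Q"
  shows "list_nerve_ar P Q y \<in> slist_hom (list_nerve_ob P) (list_nerve_ob Q)"
proof (rule slist_homI[where g = "\<lambda>n. post_comp y"])
  fix n k \<theta> s
  assume \<theta>: "\<theta> \<in> order_maps {..k} {..n}" and "s \<in> F_ob (list_nerve_ob P) n"
  then have s: "s \<in> nerve_simplices P n" by simp
  have "list_nerve_ar P Q y k (nerve_face k \<theta> a s) = [nerve_face k \<theta> a (post_comp y s)]"
    if "a < level (fst s) (\<theta> k)" for a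
    using operad.face_simplex(1)[OF P s \<theta> that] face_op_hom_comp[OF P Q y s \<theta> that]
    by (simp add: list_nerve_ar_eq)
  then have "map (list_nerve_ar P Q y k) (F_ar (list_nerve_ob P) n k \<theta> s)
      = map (\<lambda>a. [nerve_face k \<theta> a (post_comp y s)]) [0..<level (fst s) (\<theta> k)]"
    by (simp add: F_ar_nerve[OF s])
  then show "concat (map (list_nerve_ar P Q y k) (F_ar (list_nerve_ob P) n k \<theta> s))
      = F_ar (list_nerve_ob Q) n k \<theta> (post_comp y s)"
    using post_comp_simplex(1)[OF P Q y s] by (simp add: F_ar_nerve concat_map_singleton post_comp_def)
qed (use post_comp_simplex(1)[OF P Q y] in \<open>auto simp: list_nerve_ar_eq\<close>)

lemma post_comp_comp:
  assumes "s \<in> nerve_simplices P n"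
  shows "post_comp (op_hom_comp P y x) s = post_comp y (post_comp x s)"
proof -
  let ?T = "tree_operad (fst s)"
  have f: "fst (snd s) \<in> colours ?T \<rightarrow> colours P" "snd (snd s) \<in> operations ?T \<rightarrow> operations P"
    using op_homD(1,2)[OF simplexD(3)[OF assms]] by (auto simp only: PiE_def)
  show ?thesis
    by (simp add: post_comp_def op_hom_comp_def compose_assoc[OF f(1), of "fst y" "fst x"]
        compose_assoc[OF f(2), of "snd y" "snd x"] del: tree_operad_sel)
qed

lemma post_comp_id:
  assumes "s \<in> nerve_simplices P n"
  shows "post_comp (op_hom_id P) s = s"
  using op_homD(1,2)[OF simplexD(3)[OF assms]]
  by (simp add: post_comp_def op_hom_comp_def op_hom_id_def Id_compose PiE_def del: tree_operad_sel)

lemma list_nerve_cat_functor: "cat_functor Op_cat sList_cat list_nerve"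
proof (intro cat_functor.intro cat_functor_axioms.intro category_Op category_sList)
  fix P :: "('a, 'b) operad"
  assume P: "P \<in> Obj Op_cat"
  then have P': "operad P" by (simp add: Op_cat_def)
  show "F_ob list_nerve P \<in> Obj sList_cat"
    using list_nerve_functor[OF P'] by (simp add: list_nerve_def sList_cat_def)
  show "F_ar list_nerve P P (Id Op_cat P) = Id sList_cat (F_ob list_nerve P)"
    using post_comp_id[of _ P]
    by (auto simp: list_nerve_def sList_cat_def List_cat_def Op_cat_def list_nerve_ar_eq intro!: ext)
next
  fix P Q :: "('a, 'b) operad" and x
  assume "P \<in> Obj Op_cat" "Q \<in> Obj Op_cat" "x \<in> Hom Op_cat P Q"
  then show "F_ar list_nerve P Q x \<in> Hom sList_cat (F_ob list_nerve P) (F_ob list_nerve Q)"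
    by (simp add: Op_cat_def sList_cat_def list_nerve_def list_nerve_ar_in)
next
  fix P Q R :: "('a, 'b) operad" and x y
  assume "P \<in> Obj Op_cat" "Q \<in> Obj Op_cat" "R \<in> Obj Op_cat" "x \<in> Hom Op_cat P Q" "y \<in> Hom Op_cat Q R"
  then have P: "operad P" and Q: "operad Q" and x: "x \<in> op_hom P Q" by (simp_all add: Op_cat_def)
  then show "F_ar list_nerve P R (Comp Op_cat P Q R y x)
      = Comp sList_cat (F_ob list_nerve P) (F_ob list_nerve Q) (F_ob list_nerve R)
        (F_ar list_nerve Q R y) (F_ar list_nerve P Q x)"
    using post_comp_simplex(1)[OF P Q x] post_comp_comp[of _ P _ y x]
    by (auto simp: list_nerve_def sList_cat_def List_cat_def Op_cat_def list_nerve_ar_eq intro!: ext)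
qed

section \<open>Full faithfulness\<close>

text \<open>\<open>f b\<close> is the number of the block into which position \<open>b\<close>
  falls. Thus any division of a list into blocks, empty ones included, is the division into fibres
  of a monotone map. The induction adds blocks at the end so that old positions keep their
  numbers.\<close>

lemma monotone_blocks:
  obtains f where "\<And>b. b < length (concat xss) \<Longrightarrow> f b < length xss"
    "\<And>b c. b \<le> c \<Longrightarrow> c < length (concat xss) \<Longrightarrow> f b \<le> (f c :: nat)"
    "\<And>a. a < length xss \<Longrightarrow> map ((!) (concat xss)) (filter (\<lambda>b. f b = a) [0..<length (concat xss)]) = xss ! a"
proof (induction xss arbitrary: thesis rule: rev_induct)
  case Nil
  show ?case by (rule Nil[of "\<lambda>_. 0"]) auto
next
  case (snoc xs xss)
  obtain f where f: "\<And>b. b < length (concat xss) \<Longrightarrow> f b < length xss"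
    "\<And>b c. b \<le> c \<Longrightarrow> c < length (concat xss) \<Longrightarrow> f b \<le> f c"
    "\<And>a. a < length xss \<Longrightarrow> map ((!) (concat xss)) (filter (\<lambda>b. f b = a) [0..<length (concat xss)]) = xss ! a"
    by (rule snoc.IH) (rule that)
  let ?m = "length (concat xss)"
  \<comment> \<open>The new block has index \<open>length xss\<close> and takes exactly the
    positions from \<open>?m\<close> on.\<close>
  let ?f = "\<lambda>b. if b < ?m then f b else length xss"
  have upt: "[0..<length (concat (xss @ [xs]))] = [0..<?m] @ [?m..<?m + length xs]"
    by (simp add: upt_add_eq_append[symmetric])
  have 1: "filter (\<lambda>b. ?f b = a) [?m..<?m + length xs] = (if a = length xss then [?m..<?m + length xs] else [])" for a
    by (auto simp: filter_empty_conv intro: filter_True)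
  have 2: "filter (\<lambda>b. ?f b = a) [0..<?m] = filter (\<lambda>b. f b = a) [0..<?m]" for a
    by (intro filter_cong) auto
  have 3: "filter (\<lambda>b. f b = length xss) [0..<?m] = []"
    using f(1) by (fastforce simp: filter_empty_conv)
  show ?case
  proof (rule snoc.prems[of ?f])
    show "?f b < length (xss @ [xs])" if "b < length (concat (xss @ [xs]))" for b
      using f(1)[of b] by auto
    show "?f b \<le> ?f c" if "b \<le> c" "c < length (concat (xss @ [xs]))" for b c
      using f(1)[of b] f(2)[of b c] that by auto
    show "map ((!) (concat (xss @ [xs]))) (filter (\<lambda>b. ?f b = a) [0..<length (concat (xss @ [xs]))]) = (xss @ [xs]) ! a"
      if "a < length (xss @ [xs])" for a
    proof (cases "a < length xss")
      case True
      then have "filter (\<lambda>b. ?f b = a) [0..<length (concat (xss @ [xs]))] = filter (\<lambda>b. f b = a) [0..<?m]"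
        by (simp only: upt filter_append 1 2) simp
      moreover have "map ((!) (concat (xss @ [xs]))) (filter (\<lambda>b. f b = a) [0..<?m])
          = map ((!) (concat xss)) (filter (\<lambda>b. f b = a) [0..<?m])"
        by (auto simp: nth_append)
      ultimately show ?thesis using f(3)[OF True] True by (simp add: nth_append)
    next
      case False
      then have a: "a = length xss" using that by simp
      then have "filter (\<lambda>b. ?f b = a) [0..<length (concat (xss @ [xs]))] = [?m..<?m + length xs]"
        by (simp only: upt filter_append 1 2 3) simp
      moreover have "map ((!) (concat (xss @ [xs]))) [?m..<?m + length xs] = xs"
        by (intro nth_equalityI) (auto simp: nth_append)
      ultimately show ?thesis using a by simp
    qed
  qed
qed

text \<open>A composable pair \<open>p\<close>, \<open>qs\<close> is a 2-simplex whose middle level lists the inputs of \<open>p\<close>.\<close>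

lemma composite_simplex:
  assumes P: "operad P" and pq: "composable P p qs"
  obtains s where "s \<in> nerve_simplices P 2" "level (fst s) 1 = length qs"
    "oper s 1 2 0 = p" "\<And>a. a < length qs \<Longrightarrow> oper s 0 1 a = qs ! a"
proof -
  interpret operad P by fact
  have p: "p \<in> operations P" and qs: "set qs \<subseteq> operations P" and t: "map (target P) qs = inputs P p"
    using pq by (auto simp: composable_def)
  let ?xss = "map (inputs P) qs"
  obtain f where f: "\<And>b. b < length (concat ?xss) \<Longrightarrow> f b < length ?xss"
    "\<And>b c. b \<le> c \<Longrightarrow> c < length (concat ?xss) \<Longrightarrow> f b \<le> f c"
    "\<And>a. a < length ?xss \<Longrightarrow> map ((!) (concat ?xss)) (filter (\<lambda>b. f b = a) [0..<length (concat ?xss)]) = ?xss ! a"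
    by (rule monotone_blocks[of ?xss]) (rule that)
  \<comment> \<open>The bottom level lists the inputs of all of \<open>qs\<close>, and the step
    above it records to which operation an input belongs.\<close>
  let ?l = "\<lambda>i :: nat. if i = 0 then length (concat ?xss) else if i = 1 then length qs else 1"
  let ?s = "\<lambda>(i :: nat) b. if i = 1 then f b else 0"
  define \<alpha> where "\<alpha> = \<lparr>len = 2, level = (\<lambda>i\<in>{..2}. ?l i), step = (\<lambda>i\<in>{1..2}. \<lambda>b\<in>{..<?l (i - 1)}. ?s i b)\<rparr>"
  have \<alpha>: "\<alpha> \<in> chains 2"
    unfolding \<alpha>_def by (rule chainsI) (use f(1,2) in \<open>auto simp del: length_concat\<close>)
  have lev: "level \<alpha> 0 = length (concat ?xss)" "level \<alpha> 1 = length qs" "level \<alpha> 2 = 1"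
    by (simp_all add: \<alpha>_def del: length_concat)
  have step1: "step \<alpha> 1 b = f b" if "b < length (concat ?xss)" for b
    using that by (simp add: \<alpha>_def del: length_concat)
  have step2: "step \<alpha> 2 b = 0" if "b < length qs" for b
    using that by (simp add: \<alpha>_def)
  have fib1: "fibre \<alpha> 0 1 a = filter (\<lambda>b. f b = a) [0..<length (concat ?xss)]" for a
    unfolding fibre_def lev using step1 by (intro filter_cong) (simp_all add: link_def del: length_concat)
  have fib2: "fibre \<alpha> 1 2 0 = [0..<length qs]"
    unfolding fibre_def lev using step2 by (intro filter_True) (simp add: link_def numeral_2_eq_2)
  define c where "c = (\<lambda>(i :: nat, a). if i = 0 then concat ?xss ! a else if i = 1 then inputs P p ! a else target P p)"
  define h where "h = (\<lambda>(i :: nat, a). if i = 1 then qs ! a else p)"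
  have len: "length (inputs P p) = length qs" by (simp flip: t)
  have root: "rooted \<alpha>" by (simp add: rooted_def \<alpha>_def)
  have c_in: "c (i, a) \<in> colours P" if "i \<le> 2" "a < level \<alpha> i" for i a
  proof -
    consider "i = 0" | "i = 1" | "i = 2" using \<open>i \<le> 2\<close> by linarith
    then show ?thesis
    proof cases
      case 1
      then have "concat ?xss ! a \<in> set (concat ?xss)" using that lev(1) by (intro nth_mem) simp
      then show ?thesis using 1 qs inputs_in by (auto simp: c_def)
    next
      case 2
      then have "inputs P p ! a \<in> set (inputs P p)" using that lev(2) len by (intro nth_mem) simp
      then show ?thesis using 2 inputs_in[OF p] by (auto simp: c_def)
    qed (use p target_in in \<open>simp add: c_def\<close>)
  qed
  have h_in: "h (Suc i, a) \<in> operations P \<and> inputs P (h (Suc i, a)) = map (\<lambda>b. c (i, b)) (fibre \<alpha> i (Suc i) a)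
      \<and> target P (h (Suc i, a)) = c (Suc i, a)" if "Suc i \<le> 2" "a < level \<alpha> (Suc i)" for i a
  proof -
    consider "i = 0" | "i = 1" using \<open>Suc i \<le> 2\<close> by linarith
    then show ?thesis
    proof cases
      case 1
      then have a: "a < length qs" using that(2) lev(2) by simp
      \<comment> \<open>By the choice of \<open>f\<close> the fibre over \<open>a\<close> is the
        block of inputs of \<open>qs ! a\<close>. The target of \<open>qs ! a\<close> is the
        \<open>a\<close>-th input of \<open>p\<close> by composability.\<close>
      have "map ((!) (concat ?xss)) (fibre \<alpha> 0 1 a) = inputs P (qs ! a)"
        using f(3)[of a] a unfolding fib1 by simp
      moreover have "qs ! a \<in> operations P" using a qs by auto
      ultimately show ?thesis using 1 a nth_map[OF a, of "target P"] unfolding t by (simp add: c_def h_def)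
    next
      case 2
      have "map ((!) (inputs P p)) [0..<length qs] = inputs P p" unfolding len[symmetric] by (rule map_nth)
      then show ?thesis using 2 that(2) lev(3) fib2 p by (simp add: c_def h_def numeral_2_eq_2)
    qed
  qed
  obtain s where s: "s \<in> nerve_simplices P 2" "fst s = \<alpha>"
    "\<And>i a. Suc i \<le> 2 \<Longrightarrow> a < level \<alpha> (Suc i) \<Longrightarrow> oper s i (Suc i) a = h (Suc i, a)"
    by (rule simplex_of_labels[OF P \<alpha> root, where f = c and h = h, OF c_in h_in], assumption+) (rule that)
  show thesis
  proof (rule that[OF s(1)])
    show "level (fst s) 1 = length qs" using s(2) lev by simp
    show "oper s 1 2 0 = p" using s(3)[of 1 0] lev(3) by (simp add: h_def numeral_2_eq_2)
    show "oper s 0 1 a = qs ! a" if "a < length qs" for a using s(3)[of 0 a] lev(2) that by (simp add: h_def)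
  qed
qed

section \<open>Vertices and edges of a simplex\<close>

definition vertex_map :: "nat \<Rightarrow> nat \<Rightarrow> nat" where
  "vertex_map i = (\<lambda>k\<in>{..0}. i)"

text \<open>The case \<open>i = j\<close> is included on purpose: the edge is then degenerate, and
  it makes units visible.\<close>

definition edge_map :: "nat \<Rightarrow> nat \<Rightarrow> nat \<Rightarrow> nat" where
  "edge_map i j = (\<lambda>k\<in>{..1}. if k = 0 then i else j)"

lemma vertex_map: "i \<le> n \<Longrightarrow> vertex_map i \<in> order_maps {..0} {..n}" "vertex_map i 0 = i"
  by (auto simp: vertex_map_def order_maps_def intro!: mono_onI)

lemma edge_map: "i \<le> j \<Longrightarrow> j \<le> n \<Longrightarrow> edge_map i j \<in> order_maps {..1} {..n}"
  "edge_map i j 0 = i" "edge_map i j 1 = j"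
  by (auto simp: edge_map_def order_maps_def intro!: mono_onI)

context operad
begin

lemma vertex_simplex:
  assumes "s \<in> nerve_simplices P n" "i \<le> n" "a < level (fst s) i"
  shows "nerve_face 0 (vertex_map i) a s \<in> nerve_simplices P 0"
    and "colr (nerve_face 0 (vertex_map i) a s) 0 0 = colr s i a"
  using face_simplex(1)[OF assms(1) vertex_map(1)[OF assms(2)], of a]
    face_simplex(4)[OF assms(1) vertex_map(1)[OF assms(2)], of a 0 0] assms(3)
  by (simp_all add: vertex_map fibre_refl)

text \<open>The third conclusion makes fibre sizes visible as level sizes of edges, which is what
  the preservation of shapes rests on.\<close>

lemma edge_simplex:
  assumes "s \<in> nerve_simplices P n" "i \<le> j" "j \<le> n" "a < level (fst s) j"
  shows "nerve_face 1 (edge_map i j) a s \<in> nerve_simplices P 1"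
    and "oper (nerve_face 1 (edge_map i j) a s) 0 1 0 = oper s i j a"
    and "level (fst (nerve_face 1 (edge_map i j) a s)) 0 = length (fibre (fst s) i j a)"
  using face_simplex(1)[OF assms(1) edge_map(1)[OF assms(2,3)], of a]
    face_simplex(3)[OF assms(1) edge_map(1)[OF assms(2,3)], of a 0]
    face_simplex(6)[OF assms(1) edge_map(1)[OF assms(2,3)], of a 0 1 0] assms(4)
  by (simp_all add: edge_map edge_map(3)[simplified] fibre_refl)

lemma vertex_eqI:
  assumes s: "s \<in> nerve_simplices P 0" and t: "t \<in> nerve_simplices P 0" and "colr s 0 0 = colr t 0 0"
  shows "s = t"
proof (rule simplex_eqI[OF s t])
  show "fst s = fst t"
    using simplexD[OF s] simplexD[OF t] by (intro chain_eqI[where n = 0]) auto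
qed (use assms(3) simplexD(5)[OF s] in auto)

text \<open>An operation determines its inputs and its target. The number of inputs fixes the bottom
  level and so the shape, and the inputs and the target are the colours of the 1-simplex.\<close>

lemma edge_eqI:
  assumes s: "s \<in> nerve_simplices P 1" and t: "t \<in> nerve_simplices P 1" and eq: "oper s 0 1 0 = oper t 0 1 0"
  shows "s = t"
proof -
  have "inputs P (oper s 0 1 0) = map (colr s 0) [0..<level (fst s) 0] \<and> target P (oper s 0 1 0) = colr s 1 0"
    if s: "s \<in> nerve_simplices P 1" for s
    using oper_in[OF s, of 0 1 0] fibre_rooted[OF simplexD(1,2)[OF s], of 0] simplexD(5)[OF s] by simp
  from this[OF s] this[OF t] eq
  have in_eq: "map (colr s 0) [0..<level (fst s) 0] = map (colr t 0) [0..<level (fst t) 0]"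
    and out_eq: "colr s 1 0 = colr t 1 0" by simp_all
  have lev0: "level (fst s) 0 = level (fst t) 0" using arg_cong[OF in_eq, of length] by simp
  have fib: "length (fibre (fst s) 0 (Suc 0) 0) = level (fst s) 0" if "s \<in> nerve_simplices P 1" for s
    using fibre_rooted[OF simplexD(1,2)[OF that], of 0] by simp
  have 01: "i = 0 \<or> i = 1" if "i \<le> 1" for i :: nat using that by linarith
  have lev: "level (fst s) i = level (fst t) i" if "i \<le> 1" for i
    using 01[OF that] lev0 simplexD(5)[OF s] simplexD(5)[OF t] by auto
  show ?thesis
  proof (rule simplex_eqI[OF s t])
    show "fst s = fst t"
      using lev0 simplexD(5)[OF s] fib[OF s] fib[OF t]
      by (intro chain_eqI[OF simplexD(1)[OF s] simplexD(1)[OF t] lev]) auto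
    show "colr s i a = colr t i a" if "i \<le> 1" "a < level (fst s) i" for i a
      using 01[OF that(1)] that(2) in_eq lev0 out_eq simplexD(5)[OF s] by auto
    show "oper s i (Suc i) a = oper t i (Suc i) a" if "Suc i \<le> 1" "a < level (fst s) (Suc i)" for i a
      using that eq simplexD(5)[OF s] by simp
  qed
qed

text \<open>The 1-simplex is the upper edge of the 2-simplex that composes \<open>p\<close> with
  units.\<close>

lemma ex_edge:
  assumes "p \<in> operations P"
  shows "\<exists>s\<in>nerve_simplices P 1. oper s 0 1 0 = p"
proof -
  have "composable P p (map (op_unit P) (inputs P p))"
    using assms inputs_in[OF assms] unit_in target_unit by (auto simp: composable_def intro!: map_idI)
  then obtain s where s: "s \<in> nerve_simplices P 2" "oper s 1 2 0 = p"
    by (rule composite_simplex[OF operad_axioms])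
  with edge_simplex[OF s(1), of 1 2 0] simplexD(5)[OF s(1)] show ?thesis by auto
qed

text \<open>The 0-simplex is the target vertex of an edge carrying the unit of
  \<open>c\<close>.\<close>

lemma ex_vertex:
  assumes "c \<in> colours P"
  shows "\<exists>s\<in>nerve_simplices P 0. colr s 0 0 = c"
proof -
  obtain s where s: "s \<in> nerve_simplices P 1" "oper s 0 1 0 = op_unit P c"
    using ex_edge[OF unit_in[OF assms]] by blast
  with oper_in(3)[OF s(1), of 0 1 0] simplexD(5)[OF s(1)] target_unit[OF assms]
  have "colr s 1 0 = c" by simp
  with vertex_simplex[OF s(1), of 1 0] simplexD(5)[OF s(1)] show ?thesis by auto
qed

end

section \<open>Faithfulness and fullness\<close>

text \<open>Every colour and every operation labels some 0- or 1-simplex, and post-composition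
  applies the map of operads to that label.\<close>

lemma list_nerve_faithful:
  assumes P: "operad P" and Q: "operad Q" and x: "x \<in> op_hom P Q" and y: "y \<in> op_hom P Q"
    and eq: "list_nerve_ar P Q x = list_nerve_ar P Q y"
  shows "x = y"
proof (rule op_hom_eqI[OF x y])
  have post: "post_comp x s = post_comp y s" if "s \<in> nerve_simplices P n" for s n
    using fun_cong[OF fun_cong[OF eq, of n], of s] that by (simp add: list_nerve_ar_eq)
  fix c assume "c \<in> colours P"
  then obtain s where s: "s \<in> nerve_simplices P 0" "colr s 0 0 = c" using operad.ex_vertex[OF P] by blast
  show "fst x c = fst y c"
    using post_comp_simplex(2)[OF P Q x s(1), of 0 0] post_comp_simplex(2)[OF P Q y s(1), of 0 0]
      post[OF s(1)] s(2) simplexD(5)[OF s(1)] by simp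
next
  have post: "post_comp x s = post_comp y s" if "s \<in> nerve_simplices P n" for s n
    using fun_cong[OF fun_cong[OF eq, of n], of s] that by (simp add: list_nerve_ar_eq)
  fix p assume "p \<in> operations P"
  then obtain s where s: "s \<in> nerve_simplices P 1" "oper s 0 1 0 = p" using operad.ex_edge[OF P] by blast
  show "snd x p = snd y p"
    using post_comp_simplex(3)[OF P Q x s(1), of 0 1 0] post_comp_simplex(3)[OF P Q y s(1), of 0 1 0]
      post[OF s(1)] s(2) simplexD(5)[OF s(1)] by simp
qed

lemma list_nerve_full:
  assumes P: "operad P" and Q: "operad Q" and \<eta>: "\<eta> \<in> slist_hom (list_nerve_ob P) (list_nerve_ob Q)"
  shows "\<exists>y\<in>op_hom P Q. list_nerve_ar P Q y = \<eta>"
proof -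
  interpret P: operad P by fact
  interpret Q: operad Q by fact
  define g where "g n s = hd (\<eta> n s)" for n s
  have \<eta>_eq: "\<eta> n s = [g n s]" and g: "g n s \<in> nerve_simplices Q n" if "s \<in> nerve_simplices P n" for n s
    using slist_homD(2,3)[OF \<eta>, of s n] that by (simp_all add: g_def)
  have nat: "map (\<lambda>a. g k (nerve_face k \<theta> a s)) [0..<level (fst s) (\<theta> k)]
      = map (\<lambda>a. nerve_face k \<theta> a (g n s)) [0..<level (fst (g n s)) (\<theta> k)]"
    if s: "s \<in> nerve_simplices P n" and \<theta>: "\<theta> \<in> order_maps {..k} {..n}" for s n k \<theta>
  proof -
    have "map (\<eta> k) (F_ar (list_nerve_ob P) n k \<theta> s)
        = map (\<lambda>a. [g k (nerve_face k \<theta> a s)]) [0..<level (fst s) (\<theta> k)]"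
      using \<eta>_eq P.face_simplex(1)[OF s \<theta>] by (simp add: F_ar_nerve[OF s])
    from arg_cong[OF this, of concat]
    have "concat (map (\<eta> k) (F_ar (list_nerve_ob P) n k \<theta> s))
        = map (\<lambda>a. g k (nerve_face k \<theta> a s)) [0..<level (fst s) (\<theta> k)]"
      by (simp only: concat_map_singleton)
    then show ?thesis
      using slist_homD(4)[OF \<eta> \<theta>, of s] s by (simp add: F_ar_nerve[OF g[OF s]] flip: g_def)
  qed
  \<comment> \<open>Equal lists of faces have equal lengths and equal entries; the equality of
    lengths is what allows entries at the same index to be compared.\<close>
  have level_g: "level (fst (g n s)) (\<theta> k) = level (fst s) (\<theta> k)"
    and face_g: "a < level (fst s) (\<theta> k) \<Longrightarrow> g k (nerve_face k \<theta> a s) = nerve_face k \<theta> a (g n s)"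
    if "s \<in> nerve_simplices P n" "\<theta> \<in> order_maps {..k} {..n}" for s n k \<theta> a
  proof -
    show eq: "level (fst (g n s)) (\<theta> k) = level (fst s) (\<theta> k)"
      using arg_cong[OF nat[OF that], of length] by simp
    show "g k (nerve_face k \<theta> a s) = nerve_face k \<theta> a (g n s)" if "a < level (fst s) (\<theta> k)"
      using nat[OF \<open>s \<in> _\<close> \<open>\<theta> \<in> _\<close>] that unfolding eq by simp
  qed
  \<comment> \<open>The list of vertices at \<open>i\<close> has one entry for each element of level
    \<open>i\<close>.\<close>
  have lev: "level (fst (g n s)) i = level (fst s) i" if "s \<in> nerve_simplices P n" "i \<le> n" for s n i
    using level_g[OF that(1) vertex_map(1)[OF that(2)]] by (simp add: vertex_map)
  have fst_g: "fst (g n s) = fst s" if s: "s \<in> nerve_simplices P n" for s n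
  proof (rule chain_eqI[OF simplexD(1)[OF g[OF s]] simplexD(1)[OF s] lev[OF s]])
    fix i a assume i: "Suc i \<le> n" and a': "a < level (fst (g n s)) (Suc i)"
    then have a: "a < level (fst s) (Suc i)" by (simp add: lev[OF s])
    let ?e = "edge_map i (Suc i)"
    \<comment> \<open>The size of the fibre over \<open>a\<close> is the size of the bottom level of
      an edge. As \<open>g\<close> commutes with taking that edge, \<open>lev\<close> applied to the
      edge gives the claim.\<close>
    have "length (fibre (fst (g n s)) i (Suc i) a) = level (fst (nerve_face 1 ?e a (g n s))) 0"
      using Q.edge_simplex(3)[OF g[OF s] _ i a', of i] by simp
    also have "\<dots> = level (fst (g 1 (nerve_face 1 ?e a s))) 0"
      using face_g[OF s edge_map(1)[OF _ i, of i], of a] a by (simp add: edge_map(3)[simplified])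
    also have "\<dots> = level (fst (nerve_face 1 ?e a s)) 0"
      using P.edge_simplex(1)[OF s _ i a, of i] by (intro lev) simp_all
    also have "\<dots> = length (fibre (fst s) i (Suc i) a)"
      using P.edge_simplex(3)[OF s _ i a, of i] by simp
    finally show "length (fibre (fst (g n s)) i (Suc i) a) = length (fibre (fst s) i (Suc i) a)" .
  qed
  \<comment> \<open>By \<open>vertex_eqI\<close> and \<open>edge_eqI\<close> at most one simplex
    carries the given label, and by \<open>ex_vertex\<close> and \<open>ex_edge\<close> one exists
    for each colour and operation of \<open>P\<close>; hence the descriptions are meaningful
    there.\<close>
  define F where "F c = colr (g 0 (THE s. s \<in> nerve_simplices P 0 \<and> colr s 0 0 = c)) 0 0" for c
  define G where "G p = oper (g 1 (THE s. s \<in> nerve_simplices P 1 \<and> oper s 0 1 0 = p)) 0 1 0" for p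
  have F: "F (colr s 0 0) = colr (g 0 s) 0 0" if "s \<in> nerve_simplices P 0" for s
  proof -
    have "(THE t. t \<in> nerve_simplices P 0 \<and> colr t 0 0 = colr s 0 0) = s"
      using that P.vertex_eqI by (intro the_equality) auto
    then show ?thesis by (simp add: F_def)
  qed
  have G: "G (oper s 0 1 0) = oper (g 1 s) 0 1 0" if "s \<in> nerve_simplices P 1" for s
  proof -
    have "(THE t. t \<in> nerve_simplices P 1 \<and> oper t 0 1 0 = oper s 0 1 0) = s"
      using that P.edge_eqI by (intro the_equality) auto
    then show ?thesis by (simp add: G_def)
  qed
  have colr_g: "colr (g n s) i a = F (colr s i a)"
    if s: "s \<in> nerve_simplices P n" and i: "i \<le> n" "a < level (fst s) i" for s n i a
    using face_g[OF s vertex_map(1)[OF i(1)], of a] P.vertex_simplex[OF s i] F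
      Q.vertex_simplex(2)[OF g[OF s] i(1)] i(2) by (metis fst_g s vertex_map(2))
  have oper_g: "oper (g n s) i j a = G (oper s i j a)"
    if s: "s \<in> nerve_simplices P n" and i: "i \<le> j" "j \<le> n" "a < level (fst s) j" for s n i j a
    using face_g[OF s edge_map(1)[OF i(1,2)], of a] P.edge_simplex(1,2)[OF s i] G
      Q.edge_simplex(2)[OF g[OF s] i(1,2)] i(3) by (metis fst_g s edge_map(3))
  have edge: "\<exists>s\<in>nerve_simplices P 1. oper s 0 1 0 = p \<and> level (fst s) 1 = 1" if "p \<in> operations P" for p
    using P.ex_edge[OF that] simplexD(5) by blast
  have vertex: "\<exists>s\<in>nerve_simplices P 0. colr s 0 0 = c \<and> level (fst s) 0 = 1" if "c \<in> colours P" for c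
    using P.ex_vertex[OF that] simplexD(5) by blast
  have F_in: "F c \<in> colours Q" and G_unit: "G (op_unit P c) = op_unit Q (F c)" if c: "c \<in> colours P" for c
  proof -
    \<comment> \<open>On a 0-simplex \<open>oper s 0 0 0\<close> is the unit of its colour, in
      \<open>P\<close> as well as in \<open>Q\<close>, and \<open>oper_g\<close> carries one to the
      other along the degenerate edge.\<close>
    obtain s where s: "s \<in> nerve_simplices P 0" "colr s 0 0 = c" "level (fst s) 0 = 1"
      using vertex[OF c] by blast
    show "F c \<in> colours Q" "G (op_unit P c) = op_unit Q (F c)"
      using Q.colr_in[OF g[OF s(1)], of 0 0] Q.oper_refl[OF g[OF s(1)], of 0 0] P.oper_refl[OF s(1), of 0 0]
        colr_g[OF s(1), of 0 0] oper_g[OF s(1), of 0 0 0] s(2,3) by (simp_all add: fst_g[OF s(1)])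
  qed
  have G_in: "G p \<in> operations Q" and G_inputs: "inputs Q (G p) = map F (inputs P p)"
    and G_target: "target Q (G p) = F (target P p)" if p: "p \<in> operations P" for p
  proof -
    obtain s where s: "s \<in> nerve_simplices P 1" "oper s 0 1 0 = p" "level (fst s) 1 = 1"
      using edge[OF p] by blast
    have lvl: "(0 :: nat) < level (fst (g 1 s)) 1" "(0 :: nat) < level (fst s) 1" "(0 :: nat) \<le> 1" "(1 :: nat) \<le> 1"
      unfolding fst_g[OF s(1)] using s(3) by simp_all
    note q = Q.oper_in[OF g[OF s(1)] lvl(3,4,1)] and r = P.oper_in[OF s(1) lvl(3,4,2)]
      and Gp = oper_g[OF s(1) lvl(3,4,2), unfolded s(2)]
    show "G p \<in> operations Q" using q(1) Gp by simp
    show "inputs Q (G p) = map F (inputs P p)"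
      using q(2) r(2) Gp s(2) colr_g[OF s(1), of 0] unfolding fst_g[OF s(1)] by (simp add: set_fibre)
    show "target Q (G p) = F (target P p)"
      using q(3) r(3) Gp s(2) colr_g[OF s(1) lvl(4,2)] by simp
  qed
  have G_comp: "G (op_comp P p qs) = op_comp Q (G p) (map G qs)" if pq: "composable P p qs" for p qs
  proof -
    obtain s where s: "s \<in> nerve_simplices P 2" "level (fst s) 1 = length qs"
      "oper s 1 2 0 = p" "\<And>a. a < length qs \<Longrightarrow> oper s 0 1 a = qs ! a"
      by (rule composite_simplex[OF P pq]) (rule that)
    have top: "0 < level (fst s) 2" using simplexD(5)[OF s(1)] by simp
    have fib: "fibre (fst s) 1 2 0 = [0..<length qs]"
      using fibre_rooted[OF simplexD(1,2)[OF s(1)], of 1] s(2) by simp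
    have 1: "map (oper s 0 1) [0..<length qs] = qs"
      using s(4) by (intro nth_equalityI) auto
    have 2: "map (oper (g 2 s) 0 1) [0..<length qs] = map G qs"
      using s(4) oper_g[OF s(1), of 0 1] s(2) by (intro nth_equalityI) auto
    \<comment> \<open>The composite is the long edge of the 2-simplex. As \<open>g\<close> keeps the
      shape, the long edge of \<open>g 2 s\<close> splits over the same fibre.\<close>
    have "op_comp P p qs = oper s 0 2 0"
      using P.oper_comp[OF s(1), of 0 1 2 0, unfolded fib s(3) 1] top by simp
    also have "G \<dots> = oper (g 2 s) 0 2 0" using oper_g[OF s(1), of 0 2 0] top by simp
    also have "\<dots> = op_comp Q (oper (g 2 s) 1 2 0) (map G qs)"
      using Q.oper_comp[OF g[OF s(1)], of 0 1 2 0, unfolded fst_g[OF s(1)] fib 2] top by simp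
    also have "oper (g 2 s) 1 2 0 = G p" using oper_g[OF s(1), of 1 2 0, unfolded s(3)] top by simp
    finally show ?thesis .
  qed
  define y where "y = (\<lambda>c\<in>colours P. F c, \<lambda>p\<in>operations P. G p)"
  have comp: "p \<in> operations P \<and> set qs \<subseteq> operations P \<and> op_comp P p qs \<in> operations P"
    if "composable P p qs" for p qs
    using that P.comp_in by (auto simp: composable_def)
  have map: "map (restrict k A) xs = map k xs" if "set xs \<subseteq> A" for A xs and k :: "'z \<Rightarrow> 'w"
    using that by auto
  have y: "y \<in> op_hom P Q"
    unfolding y_def
    by (intro op_homI)
      (use comp in \<open>auto simp: map F_in G_in G_inputs G_target G_unit G_comp P.inputs_in P.target_in P.unit_in\<close>)
  have y_eq: "c \<in> colours P \<Longrightarrow> fst y c = F c" "p \<in> operations P \<Longrightarrow> snd y p = G p" for c p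
    by (simp_all add: y_def)
  have fst_post: "fst (post_comp y s) = fst s" for s :: "('a, 'b) nerve_simplex"
    by (simp add: post_comp_def)
  \<comment> \<open>Both simplices have the shape of \<open>s\<close>, and the labels of both are
    the images under \<open>F\<close> and \<open>G\<close> of the labels of
    \<open>s\<close>.\<close>
  have "post_comp y s = g n s" if s: "s \<in> nerve_simplices P n" for s n
  proof (rule Q.simplex_eqI[OF post_comp_simplex(1)[OF P Q y s] g[OF s]])
    show "fst (post_comp y s) = fst (g n s)" by (simp add: fst_g[OF s] fst_post)
    show "colr (post_comp y s) i a = colr (g n s) i a" if "i \<le> n" "a < level (fst (post_comp y s)) i" for i a
      using that post_comp_simplex(2)[OF P Q y s, of i a] colr_g[OF s, of i a] P.colr_in[OF s, of i a]
      by (simp add: fst_post y_eq)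
    show "oper (post_comp y s) i (Suc i) a = oper (g n s) i (Suc i) a"
      if "Suc i \<le> n" "a < level (fst (post_comp y s)) (Suc i)" for i a
      using that post_comp_simplex(3)[OF P Q y s, of i "Suc i" a] oper_g[OF s, of i "Suc i" a]
        P.oper_in(1)[OF s, of i "Suc i" a]
      by (simp add: fst_post y_eq)
  qed
  then have "list_nerve_ar P Q y n = \<eta> n" for n
    using \<eta>_eq slist_homD(1)[OF \<eta>, of n]
    by (intro extensionalityI[where A = "nerve_simplices P n"]) (auto simp: list_nerve_ar_eq PiE_def)
  then show ?thesis using y by blast
qed

theorem mainTheorem5:
  "fully_faithful_functor
     (Op_cat :: (('c, 'o) operad, ('c \<Rightarrow> 'c) \<times> ('o \<Rightarrow> 'o)) category)
     (sList_cat :: (('c, 'o) nerve_simplex slist,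
        nat \<Rightarrow> ('c, 'o) nerve_simplex \<Rightarrow> ('c, 'o) nerve_simplex list) category)
     list_nerve"
proof (intro fully_faithful_functor.intro fully_faithful_functor_axioms.intro list_nerve_cat_functor)
  fix P Q :: "('c, 'o) operad"
  assume "P \<in> Obj Op_cat" "Q \<in> Obj Op_cat"
  then have P: "operad P" and Q: "operad Q" by (simp_all add: Op_cat_def)
  have "bij_betw (list_nerve_ar P Q) (op_hom P Q) (slist_hom (list_nerve_ob P) (list_nerve_ob Q))"
    using list_nerve_ar_in[OF P Q] list_nerve_full[OF P Q] list_nerve_faithful[OF P Q]
    by (fastforce simp: bij_betw_def inj_on_def)
  then show "bij_betw (F_ar list_nerve P Q) (Hom Op_cat P Q) (Hom sList_cat (F_ob list_nerve P) (F_ob list_nerve Q))"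
    by (simp add: list_nerve_def Op_cat_def sList_cat_def)
qed

end
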